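(* Let $\mathcal R^q:\mathcal A^{\mathbb N}\to\mathcal A^{\mathbb N}$ be the $\mathcal A$-module endomorphism $P\mapsto\hat P$ given, for $\alpha\ge0$, $\beta\ge1$ and with $p_{-1}^q=p_{-1}^m=0$, by $$\hat p_0=u_xp_0+p_1^r,\quad \hat p_\alpha^q=q_{\alpha,x}p_0+p_{\alpha-1}^q,\quad \hat p_\alpha^m=m_{\alpha,x}p_0-\frac1t\,p_{\alpha-1}^m-\frac zt\,p_\alpha^m,\quad \hat p_\beta^r=r_{\beta,x}p_0-p_{\beta+1}^r,$$ and let $\mathcal R^m=t\,\mathcal R^q+z\,\mathcal I$, where $\mathcal I$ is the identity map of $\mathcal A^{\mathbb N}$. Then $\mathcal R^q$ and $\mathcal R^m$ are bijective, and their inverses, $\hat P\mapsto P$, are given for all $\alpha\ge0$, $\beta\ge1$, with the notation $\hat p_0^r=-\hat p_0$, by the following formulas. For $(\mathcal R^q)^{-1}$: $$p_0=\frac{\hat p_0^q}{q_{0,x}},\qquad p_\alpha^q=-\frac{q_{\alpha+1,x}}{q_{0,x}}\hat p_0^q+\hat p_{\alpha+1}^q,$$ $$p_\alpha^m=\sum_{j=0}^\alpha\frac{t\,\hat p_j^m}{(-z)^{\alpha-j+1}}-\frac{t\,\hat p_0^q}{q_{0,x}}\sum_{j=0}^\alpha\frac{m_{j,x}}{(-z)^{\alpha-j+1}},\qquad p_\beta^r=\frac{r_{\beta-1,x}}{q_{0,x}}\hat p_0^q-\hat p_{\beta-1}^r.$$ For $(\mathcal R^m)^{-1}$: $$p_0=\frac{\hat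 p_0^m}{t\,m_{0,x}},\qquad p_\alpha^q=\sum_{j=0}^\alpha\frac{(-t)^{\alpha-j}\hat p_j^q}{z^{\alpha-j+1}}-\frac{\hat p_0^m}{m_{0,x}}\sum_{j=0}^\alpha\frac{(-t)^{\alpha-j}q_{j,x}}{z^{\alpha-j+1}},$$ $$p_\alpha^m=\frac{m_{\alpha+1,x}}{m_{0,x}}\hat p_0^m-\hat p_{\alpha+1}^m,\qquad p_\beta^r=-\sum_{j=0}^{\beta-1}\frac{z^{\beta-j-1}\hat p_j^r}{t^{\beta-j}}+\frac{\hat p_0^m}{m_{0,x}}\left(-\frac{z^\beta}{t^{\beta+1}}+\sum_{j=1}^{\beta}\frac{z^{\beta-j}r_{j-1,x}}{t^{\beta-j+1}}\right).$$ Moreover, both $(\mathcal R^q)^{-1}$ and $(\mathcal R^m)^{-1}$ leave the set $\mathrm{sym}_{\mathcal A}^{\tau^W}(\mathcal E)$ invariant (each maps it into itself), i.e. they are recursion operators for $\tau^W$-symmetries of the reduced quasi-classical self-dual Yang-Mills equation $\mathcal E$: $u_{yz}=u_{tx}-u_zu_{xx}+u_xu_{xz}$.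
   Context: A recursion operator for $\tau^W$-symmetries is an $\mathbb R$-linear map $\mathcal A^{\mathbb N}\to\mathcal A^{\mathbb N}$ that maps $\mathrm{sym}_{\mathcal A}^{\tau^W}(\mathcal E)$ into itself. **The space $\tilde{\mathcal E}^W$.** Its (internal) coordinates are: $x,y,z,t$; $u_{x^it^j}$ ($i,j\ge0$), $u_{x^iy^kt^j}$ and $u_{x^iz^lt^j}$ ($i,j\ge 0$, $k,l\ge1$); $q_\alpha^{a,b}$, $m_\alpha^{a,b}$ ($\alpha,a,b\ge0$); $r_\beta^{a,b}$ ($\beta\ge1$, $a,b\ge0$). Write $u=u_{x^0t^0}$, $q_\alpha=q_\alpha^{0,0}$, $m_\alpha=m_\alpha^{0,0}$, $r_\beta=r_\beta^{0,0}$, and set $r_0=-u$, $q_{-1}^{a,b}=m_{-1}^{a,b}=0$. Every function considered depends on finitely many of these coordinates. **The algebra $\mathcal A$.** $\mathcal A$ is the commutative $\mathbb R$-algebra generated by $\mathcal L\cup\mathcal F$, where $\mathcal F$ is the algebra of smooth functions of (finitely many of) the internal coordinates on $\tilde{\mathcal E}^W$ and $\mathcal L$ is the algebra of Laurent polynomials with real coefficients in (finitely many of) the internal coordinates. Elements of $\mathcal A$ are smooth functions defined where the finitely many inverted coordinates are nonzero, two being identified if they agree on such a common dense open set. $\mathcal A^{\mathbb N}$ is the $\mathcal A$-module of all sequences of elements of $\mathcal A$, written $P=[p_0,p_0^q,p_0^m,p_1^r,p_1^q,p_1^m,p_2^r,p_2^q,p_2^m,\ldots]$. **Total derivatives.**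 $\tilde D_x,\tilde D_y,\tilde D_z,\tilde D_t$ are the derivations (vector fields) on functions on $\tilde{\mathcal E}^W$ acting on $x,y,z,t$ as the corresponding partial derivatives and on the other coordinates as follows. Put $G=u_{tx}-u_zu_{xx}+u_xu_{xz}$. - $\tilde D_x$ and $\tilde D_t$ raise $i$, resp. $j$, by one in every $u$-coordinate. - $\tilde D_y u_{x^it^j}=u_{x^iyt^j}$, $\tilde D_yu_{x^iy^kt^j}=u_{x^iy^{k+1}t^j}$, $\tilde D_yu_{x^iz^lt^j}=\tilde D_x^i\tilde D_z^{l-1}\tilde D_t^j(G)$. - $\tilde D_z u_{x^it^j}=u_{x^izt^j}$, $\tilde D_zu_{x^iz^lt^j}=u_{x^iz^{l+1}t^j}$, $\tilde D_zu_{x^iy^kt^j}=\tilde D_x^i\tilde D_y^{k-1}\tilde D_t^j(G)$. - $\tilde D_xq_\alpha^{a,b}=q_\alpha^{a+1,b}$, $\tilde D_zq_\alpha^{a,b}=q_\alpha^{a,b+1}$, $\tilde D_yq_\alpha^{a,b}=\tilde D_x^a\tilde D_z^b(u_xq_\alpha^{1,0}+q_{\alpha-1}^{1,0})$, $\tilde D_tq_\alpha^{a,b}=\tilde D_x^a\tilde D_z^b(u_zq_\alpha^{1,0}+q_{\alpha-1}^{0,1})$. - $\tilde D_xm_\alpha^{a,b}=m_\alpha^{a+1,b}$, $\tilde D_zm_\alpha^{a,b}=m_\alpha^{a,b+1}$, $\tilde D_ym_\alpha^{a,b}=\tilde D_x^a\tilde D_z^b\big(u_xm_\alpha^{1,0}-\frac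 zt m_\alpha^{1,0}-\frac1t m_{\alpha-1}^{1,0}\big)$, $\tilde D_tm_\alpha^{a,b}=\tilde D_x^a\tilde D_z^b\big(u_zm_\alpha^{1,0}-\frac zt m_\alpha^{0,1}-\frac1t m_{\alpha-1}^{0,1}\big)$. - $\tilde D_yr_\beta^{a,b}=r_\beta^{a+1,b}$, $\tilde D_tr_\beta^{a,b}=r_\beta^{a,b+1}$, and inductively on $\beta\ge1$: $\tilde D_xr_\beta^{a,b}=\tilde D_y^a\tilde D_t^b(u_x\tilde D_xr_{\beta-1}-\tilde D_yr_{\beta-1})$, $\tilde D_zr_\beta^{a,b}=\tilde D_y^a\tilde D_t^b(u_z\tilde D_xr_{\beta-1}-\tilde D_tr_{\beta-1})$. These four derivations pairwise commute. Subscripts denote total derivatives: $q_{\alpha,x}=\tilde D_xq_\alpha=q_\alpha^{1,0}$, $m_{\alpha,x}=\tilde D_xm_\alpha=m_\alpha^{1,0}$, $r_{\beta,x}=\tilde D_xr_\beta$ (so $r_{0,x}=-u_x$), etc.; $\tilde D_{yz}=\tilde D_y\tilde D_z$, etc. **$\tau^W$-symmetries.** $\mathrm{sym}_{\mathcal A}^{\tau^W}(\mathcal E)\subset\mathcal A^{\mathbb N}$ is the real vector space of all $P\in\mathcal A^{\mathbb N}$ satisfying, for all $\alpha\ge0$, $\beta\ge2$, with $p_{-1}^q=p_{-1}^m=0$: - (NS1) $\tilde D_{yz}(p_0)-\tilde D_{tx}(p_0)+u_z\tilde D_{xx}(p_0)-u_x\tilde D_{xz}(p_0)+u_{xx}\tilde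 D_z(p_0)-u_{xz}\tilde D_x(p_0)=0$; - (NS2) $\tilde D_t(p_\alpha^q)-u_z\tilde D_x(p_\alpha^q)-q_{\alpha,x}\tilde D_z(p_0)-\tilde D_z(p_{\alpha-1}^q)=0$; - (NS3) $\tilde D_y(p_\alpha^q)-u_x\tilde D_x(p_\alpha^q)-q_{\alpha,x}\tilde D_x(p_0)-\tilde D_x(p_{\alpha-1}^q)=0$; - (NS4) $\tilde D_t(p_\alpha^m)-u_z\tilde D_x(p_\alpha^m)-m_{\alpha,x}\tilde D_z(p_0)+\frac zt\tilde D_z(p_\alpha^m)+\frac1t\tilde D_z(p_{\alpha-1}^m)=0$; - (NS5) $\tilde D_y(p_\alpha^m)-u_x\tilde D_x(p_\alpha^m)-m_{\alpha,x}\tilde D_x(p_0)+\frac zt\tilde D_x(p_\alpha^m)+\frac1t\tilde D_x(p_{\alpha-1}^m)=0$; - (NS6) $\tilde D_x(p_1^r)-\tilde D_y(p_0)+2u_x\tilde D_x(p_0)=0$; - (NS7) $\tilde D_z(p_1^r)-\tilde D_t(p_0)+u_x\tilde D_z(p_0)+u_z\tilde D_x(p_0)=0$; - (NS8) $\tilde D_x(p_\beta^r)-u_x\tilde D_x(p_{\beta-1}^r)-r_{\beta-1,x}\tilde D_x(p_0)+\tilde D_y(p_{\beta-1}^r)=0$; - (NS9) $\tilde D_z(p_\beta^r)-u_z\tilde D_x(p_{\beta-1}^r)-r_{\beta-1,x}\tilde D_z(p_0)+\tilde D_t(p_{\beta-1}^r)=0$. *)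

theory Defs
  imports "HOL-Analysis.Analysis"
begin

section \<open>The space and the algebra of functions on it\<close>

text \<open>
  The internal coordinates.  Indices that start at 1 are shifted so that every constructor
  value is a coordinate: \<open>Uy i k j\<close> is \<open>u\<close> with \<open>i\<close> subscripts \<open>x\<close>, \<open>k + 1\<close> subscripts \<open>y\<close> and
  \<open>j\<close> subscripts \<open>t\<close>; \<open>Uz i l j\<close> is \<open>u\<close> with \<open>i\<close> subscripts \<open>x\<close>, \<open>l + 1\<close> subscripts \<open>z\<close> and
  \<open>j\<close> subscripts \<open>t\<close>; \<open>Cr b i j\<close> is \<open>r\<^sub>\<beta>\<close> with \<open>\<beta> = b + 1\<close> and upper indices \<open>i, j\<close>.
\<close>

datatype coord =
    Cx | Cy | Cz | Ct
  | U nat nat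
  | Uy nat nat nat
  | Uz nat nat nat
  | Cq nat nat nat
  | Cm nat nat nat
  | Cr nat nat nat

type_synonym point = "coord \<Rightarrow> real"

definition pd :: "coord \<Rightarrow> (point \<Rightarrow> real) \<Rightarrow> point \<Rightarrow> real" where
  "pd c f p = deriv (\<lambda>s. f (p(c := s))) (p c)"

definition differentiable_in :: "coord \<Rightarrow> (point \<Rightarrow> real) \<Rightarrow> point \<Rightarrow> bool" where
  "differentiable_in c f p \<longleftrightarrow> (\<lambda>s. f (p(c := s))) field_differentiable (at (p c))"

definition depends_on :: "coord set \<Rightarrow> (point \<Rightarrow> real) \<Rightarrow> bool" where
  "depends_on S f \<longleftrightarrow> (\<forall>p p'. (\<forall>c\<in>S. p c = p' c) \<longrightarrow> f p = f p')"

text \<open>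
  The algebra \<open>\<F>\<close>: functions of finitely many coordinates all of whose iterated partial
  derivatives exist and are continuous.  Continuity refers to the product topology on points,
  which for a function of finitely many coordinates is continuity in these coordinates.
\<close>

definition smooth_fn :: "(point \<Rightarrow> real) \<Rightarrow> bool" where
  "smooth_fn f \<longleftrightarrow> (\<exists>S. finite S \<and> depends_on S f) \<and>
     (\<forall>cs. continuous_on UNIV (foldr pd cs f) \<and> (\<forall>c p. differentiable_in c (foldr pd cs f) p))"

text \<open>
  The Laurent polynomials are generated by the real constants, the coordinates (both are in
  \<open>\<F>\<close>) and the inverses of the coordinates.  Functions are total here; the value of an inverse
  coordinate at points where that coordinate vanishes is immaterial, because of the
  identification made by \<open>agree\<close>.
\<close>

inductive_set gen :: "(point \<Rightarrow> real) set" where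
  smooth: "smooth_fn f \<Longrightarrow> f \<in> gen"
| inverse_coord: "(\<lambda>p. inverse (p c)) \<in> gen"
| add: "f \<in> gen \<Longrightarrow> g \<in> gen \<Longrightarrow> (\<lambda>p. f p + g p) \<in> gen"
| mult: "f \<in> gen \<Longrightarrow> g \<in> gen \<Longrightarrow> (\<lambda>p. f p * g p) \<in> gen"

definition nonvanishing :: "coord set \<Rightarrow> point set" where
  "nonvanishing S = {p. \<forall>c\<in>S. p c \<noteq> 0}"

definition agree :: "(point \<Rightarrow> real) \<Rightarrow> (point \<Rightarrow> real) \<Rightarrow> bool" where
  "agree f g \<longleftrightarrow> (\<exists>S. finite S \<and> (\<forall>p\<in>nonvanishing S. f p = g p))"

definition represents :: "(point \<Rightarrow> real) \<Rightarrow> bool" where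
  "represents f \<longleftrightarrow> (\<exists>g\<in>gen. agree f g)"

lemma agree_refl: "agree f f"
  unfolding agree_def by auto

lemma agree_sym: "agree f g \<Longrightarrow> agree g f"
  unfolding agree_def by metis

lemma agreeI: "finite S \<Longrightarrow> (\<And>p. p \<in> nonvanishing S \<Longrightarrow> f p = g p) \<Longrightarrow> agree f g"
  unfolding agree_def by auto

lemma agree_trans: "agree f g \<Longrightarrow> agree g h \<Longrightarrow> agree f h"
proof -
  assume "agree f g" "agree g h"
  then obtain S S' where S: "finite S" "\<forall>p\<in>nonvanishing S. f p = g p"
    and S': "finite S'" "\<forall>p\<in>nonvanishing S'. g p = h p"
    unfolding agree_def by blast
  show "agree f h"
    by (rule agreeI[of "S \<union> S'"]) (use S S' in \<open>auto simp: nonvanishing_def\<close>)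
qed

lemma agree_cong2:
  assumes "agree f f'" "agree g g'"
  shows "agree (\<lambda>p. F (f p) (g p)) (\<lambda>p. F (f' p) (g' p))"
proof -
  from assms obtain S S' where S: "finite S" "\<forall>p\<in>nonvanishing S. f p = f' p"
    and S': "finite S'" "\<forall>p\<in>nonvanishing S'. g p = g' p"
    unfolding agree_def by blast
  show ?thesis
    by (rule agreeI[of "S \<union> S'"]) (use S S' in \<open>auto simp: nonvanishing_def\<close>)
qed

lemma gen_represents: "f \<in> gen \<Longrightarrow> represents f"
  unfolding represents_def using agree_refl by blast

lemma represents_cong: "agree f g \<Longrightarrow> represents g \<Longrightarrow> represents f"
  unfolding represents_def using agree_trans by blast

lemma represents_add:
  assumes "represents f" "represents g" shows "represents (\<lambda>p. f p + g p)"
proof -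
  obtain f' g' where *: "f' \<in> gen" "agree f f'" "g' \<in> gen" "agree g g'"
    using assms unfolding represents_def by blast
  show ?thesis unfolding represents_def
    by (rule bexI[OF agree_cong2[OF *(2) *(4)] gen.add[OF *(1) *(3)]])
qed

lemma represents_mult:
  assumes "represents f" "represents g" shows "represents (\<lambda>p. f p * g p)"
proof -
  obtain f' g' where *: "f' \<in> gen" "agree f f'" "g' \<in> gen" "agree g g'"
    using assms unfolding represents_def by blast
  show ?thesis unfolding represents_def
    by (rule bexI[OF agree_cong2[OF *(2) *(4)] gen.mult[OF *(1) *(3)]])
qed

lemma pd_const: "pd c (\<lambda>p. k) = (\<lambda>p. 0)"
  by (rule ext) (simp add: pd_def)

lemma foldr_pd_const: "\<exists>k'. foldr pd cs (\<lambda>p. k) = (\<lambda>p. k')"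
proof (induction cs)
  case (Cons c cs)
  then obtain k' where "foldr pd cs (\<lambda>p. k) = (\<lambda>p. k')" by blast
  then show ?case by (auto simp: pd_const)
qed auto

lemma smooth_fn_const: "smooth_fn (\<lambda>p. k)"
  unfolding smooth_fn_def
proof (intro conjI allI)
  show "\<exists>S. finite S \<and> depends_on S (\<lambda>p. k)" by (rule exI[of _ "{}"]) (simp add: depends_on_def)
  fix cs
  obtain k' where k': "foldr pd cs (\<lambda>p. k) = (\<lambda>p. k')" using foldr_pd_const by blast
  show "continuous_on UNIV (foldr pd cs (\<lambda>p. k))" by (simp add: k')
  show "differentiable_in c (foldr pd cs (\<lambda>p. k)) p" for c p
    by (simp add: k' differentiable_in_def)
qed

lemma represents_uminus: "represents f \<Longrightarrow> represents (\<lambda>p. - f p)"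
  using represents_mult[OF gen_represents[OF gen.smooth[OF smooth_fn_const[of "- 1"]]]] by simp

lemma pd_coord: "pd d (\<lambda>p. p c) = (\<lambda>p. if d = c then 1 else 0)"
  by (rule ext) (simp add: pd_def)

lemma foldr_pd_coord:
  "foldr pd cs (\<lambda>p. p c) = (\<lambda>p. p c) \<or> (\<exists>k. foldr pd cs (\<lambda>p. p c) = (\<lambda>p. k))"
proof (induction cs)
  case (Cons d cs)
  then show ?case
    by (auto simp: pd_coord pd_const)
qed auto

lemma smooth_fn_coord: "smooth_fn (\<lambda>p. p c)"
  unfolding smooth_fn_def
proof (intro conjI allI)
  show "\<exists>S. finite S \<and> depends_on S (\<lambda>p. p c)"
    by (rule exI[of _ "{c}"]) (simp add: depends_on_def)
  fix cs
  consider "foldr pd cs (\<lambda>p. p c) = (\<lambda>p. p c)" | k where "foldr pd cs (\<lambda>p. p c) = (\<lambda>p. k)"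
    using foldr_pd_coord by blast
  note cases = this
  show "continuous_on UNIV (foldr pd cs (\<lambda>p. p c))"
    by (rule cases) (simp_all add: continuous_on_product_coordinates)
  show "differentiable_in d (foldr pd cs (\<lambda>p. p c)) p" for d p
    by (rule cases) (cases "d = c"; simp add: differentiable_in_def)+
qed

lemma smooth_fn_pd: "smooth_fn f \<Longrightarrow> smooth_fn (pd c f)"
proof -
  assume f: "smooth_fn f"
  then obtain S where S: "finite S" "depends_on S f" unfolding smooth_fn_def by blast
  have "depends_on S (pd c f)"
    unfolding depends_on_def
  proof (intro allI impI)
    fix p p' :: point assume eq: "\<forall>c\<in>S. p c = p' c"
    have "f (p(c := s)) = f (p'(c := s))" for s
      using eq by (intro S(2)[unfolded depends_on_def, rule_format]) simp
    moreover have "deriv (\<lambda>s. f (p'(c := s))) (p c) = deriv (\<lambda>s. f (p'(c := s))) (p' c)"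
    proof (cases "c \<in> S")
      case True then show ?thesis using eq by simp
    next
      case False
      then have "f (p'(c := s)) = f p'" for s
        by (intro S(2)[unfolded depends_on_def, rule_format]) auto
      then show ?thesis by simp
    qed
    ultimately show "pd c f p = pd c f p'" by (simp add: pd_def)
  qed
  moreover have "continuous_on UNIV (foldr pd cs (pd c f)) \<and>
      (\<forall>d p. differentiable_in d (foldr pd cs (pd c f)) p)" for cs
  proof -
    have "foldr pd cs (pd c f) = foldr pd (cs @ [c]) f" by simp
    then show ?thesis using f unfolding smooth_fn_def by presburger
  qed
  ultimately show ?thesis using S(1) unfolding smooth_fn_def by blast
qed

lemma pd_cong:
  assumes S: "finite S" and eq: "\<And>p. p \<in> nonvanishing S \<Longrightarrow> f p = g p" and p: "p \<in> nonvanishing S"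
  shows "pd c f p = pd c g p" "differentiable_in c f p \<Longrightarrow> differentiable_in c g p"
proof -
  have ev: "\<forall>\<^sub>F s in nhds (p c). f (p(c := s)) = g (p(c := s))"
  proof (cases "c \<in> S")
    case True
    then have "p c \<noteq> 0" using p by (auto simp: nonvanishing_def)
    then have "\<forall>\<^sub>F s in nhds (p c). s \<noteq> 0" by (rule t1_space_nhds)
    then show ?thesis
    proof eventually_elim
      case (elim s)
      then have "p(c := s) \<in> nonvanishing S" using p by (simp add: nonvanishing_def)
      then show ?case by (rule eq)
    qed
  next
    case False
    then have "p(c := s) \<in> nonvanishing S" for s using p by (auto simp: nonvanishing_def)
    then show ?thesis using eq by simp
  qed
  show "pd c f p = pd c g p" unfolding pd_def by (rule deriv_cong_ev[OF ev refl])
  show "differentiable_in c f p \<Longrightarrow> differentiable_in c g p"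
    unfolding differentiable_in_def field_differentiable_def
    using DERIV_cong_ev[OF refl ev refl] by blast
qed

lemma pd_agree: "agree f g \<Longrightarrow> agree (pd c f) (pd c g)"
  unfolding agree_def using pd_cong(1) by meson

definition regular :: "(point \<Rightarrow> real) \<Rightarrow> bool" where
  "regular f \<longleftrightarrow> (\<exists>S. finite S \<and> (\<forall>c. \<forall>p\<in>nonvanishing S. differentiable_in c f p))"

lemma pd_add: "differentiable_in c f p \<Longrightarrow> differentiable_in c g p \<Longrightarrow>
    pd c (\<lambda>p. f p + g p) p = pd c f p + pd c g p"
  unfolding pd_def differentiable_in_def by (rule deriv_add)

lemma pd_mult: "differentiable_in c f p \<Longrightarrow> differentiable_in c g p \<Longrightarrow>
    pd c (\<lambda>p. f p * g p) p = f p * pd c g p + pd c f p * g p"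
  unfolding pd_def differentiable_in_def by (subst deriv_mult) simp_all

lemma gen_regular: "f \<in> gen \<Longrightarrow> regular f"
proof (induction rule: gen.induct)
  case (smooth f)
  have "differentiable_in c (foldr pd [] f) p" for c p
    using smooth unfolding smooth_fn_def by blast
  then show ?case unfolding regular_def by (intro exI[of _ "{}"]) simp
next
  case (inverse_coord c)
  show ?case unfolding regular_def
  proof (intro exI[of _ "{c}"] conjI allI ballI)
    fix d p assume "p \<in> nonvanishing {c}"
    then have "p c \<noteq> 0" by (simp add: nonvanishing_def)
    then show "differentiable_in d (\<lambda>p. inverse (p c)) p"
      by (cases "d = c") (auto simp: differentiable_in_def intro!: field_differentiable_inverse)
  qed simp
next
  case (add f g)
  then obtain S S' where "finite S" "finite S'"
    "\<And>c p. p \<in> nonvanishing S \<Longrightarrow> differentiable_in c f p"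
    "\<And>c p. p \<in> nonvanishing S' \<Longrightarrow> differentiable_in c g p"
    unfolding regular_def by blast
  then show ?case unfolding regular_def
    by (intro exI[of _ "S \<union> S'"])
      (auto simp: differentiable_in_def nonvanishing_def intro!: field_differentiable_add)
next
  case (mult f g)
  then obtain S S' where "finite S" "finite S'"
    "\<And>c p. p \<in> nonvanishing S \<Longrightarrow> differentiable_in c f p"
    "\<And>c p. p \<in> nonvanishing S' \<Longrightarrow> differentiable_in c g p"
    unfolding regular_def by blast
  then show ?case unfolding regular_def
    by (intro exI[of _ "S \<union> S'"])
      (auto simp: differentiable_in_def nonvanishing_def intro!: field_differentiable_mult)
qed

lemma represents_regular: "represents f \<Longrightarrow> regular f"
proof -
  assume "represents f"
  then obtain g S where g: "g \<in> gen" "finite S" "\<And>p. p \<in> nonvanishing S \<Longrightarrow> g p = f p"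
    unfolding represents_def agree_def by metis
  obtain S' where S': "finite S'" "\<And>c p. p \<in> nonvanishing S' \<Longrightarrow> differentiable_in c g p"
    using gen_regular[OF g(1)] unfolding regular_def by blast
  have "differentiable_in c f p" if "p \<in> nonvanishing (S \<union> S')" for c p
    using that g S' by (intro pd_cong(2)[of "S \<union> S'" g f]) (auto simp: nonvanishing_def)
  then show ?thesis unfolding regular_def using g(2) S'(1) by blast
qed

lemma pd_add_agree:
  assumes "regular f" "regular g"
  shows "agree (pd c (\<lambda>p. f p + g p)) (\<lambda>p. pd c f p + pd c g p)"
proof -
  from assms obtain S S' where "finite S" "finite S'"
    "\<And>c p. p \<in> nonvanishing S \<Longrightarrow> differentiable_in c f p"
    "\<And>c p. p \<in> nonvanishing S' \<Longrightarrow> differentiable_in c g p"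
    unfolding regular_def by blast
  then show ?thesis
    by (intro agreeI[of "S \<union> S'"]) (auto simp: nonvanishing_def intro!: pd_add)
qed

lemma pd_mult_agree:
  assumes "regular f" "regular g"
  shows "agree (pd c (\<lambda>p. f p * g p)) (\<lambda>p. f p * pd c g p + pd c f p * g p)"
proof -
  from assms obtain S S' where "finite S" "finite S'"
    "\<And>c p. p \<in> nonvanishing S \<Longrightarrow> differentiable_in c f p"
    "\<And>c p. p \<in> nonvanishing S' \<Longrightarrow> differentiable_in c g p"
    unfolding regular_def by blast
  then show ?thesis
    by (intro agreeI[of "S \<union> S'"]) (auto simp: nonvanishing_def intro!: pd_mult)
qed

lemma pd_inverse_agree:
  "agree (pd d (\<lambda>p. inverse (p c)))
     (\<lambda>p. (if d = c then - 1 else 0) * (inverse (p c) * inverse (p c)))"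
proof (rule agreeI[of "{c}"])
  fix p assume "p \<in> nonvanishing {c}"
  then have nz: "p c \<noteq> 0" by (simp add: nonvanishing_def)
  show "pd d (\<lambda>p. inverse (p c)) p =
      (if d = c then - 1 else 0) * (inverse (p c) * inverse (p c))"
  proof (cases "d = c")
    case True
    have "(inverse has_field_derivative - (inverse (p c) ^ Suc (Suc 0))) (at (p c))"
      using DERIV_inverse[OF nz] by blast
    then show ?thesis using True by (simp add: pd_def DERIV_imp_deriv)
  qed (simp add: pd_def)
qed simp

lemma pd_gen: "f \<in> gen \<Longrightarrow> represents (pd c f)"
proof (induction rule: gen.induct)
  case (smooth f)
  then show ?case by (intro gen_represents gen.smooth smooth_fn_pd)
next
  case (inverse_coord d)
  show ?case
    by (rule represents_cong[OF pd_inverse_agree])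
      (intro represents_mult gen_represents gen.inverse_coord gen.smooth smooth_fn_const)
next
  case (add f g)
  then show ?case
    by (intro represents_cong[OF pd_add_agree] gen_regular represents_add)
next
  case (mult f g)
  then show ?case
    by (intro represents_cong[OF pd_mult_agree] gen_regular represents_add represents_mult)
      (auto intro: gen_represents)
qed

lemma represents_pd: "represents f \<Longrightarrow> represents (pd c f)"
proof -
  assume "represents f"
  then obtain g where "g \<in> gen" "agree f g" unfolding represents_def by blast
  then show ?thesis using pd_agree pd_gen represents_cong by blast
qed

lemma depends_on_comb:
  assumes "depends_on S f" "depends_on S' g"
  shows "depends_on (S \<union> S') (\<lambda>p. F (f p) (g p))"
  unfolding depends_on_def
proof (intro allI impI)
  fix p p' :: point assume eq: "\<forall>c\<in>S \<union> S'. p c = p' c"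
  have "f p = f p'" "g p = g p'" using assms eq unfolding depends_on_def by (meson UnI1 UnI2)+
  then show "F (f p) (g p) = F (f p') (g p')" by simp
qed

lemma represents_finite:
  assumes "represents f" shows "\<exists>S. finite S \<and> (\<forall>c. c \<notin> S \<longrightarrow> agree (pd c f) (\<lambda>p. 0))"
proof -
  have *: "\<exists>S. finite S \<and> depends_on S f" if "f \<in> gen" for f
    using that
  proof (induction rule: gen.induct)
    case (smooth f) then show ?case unfolding smooth_fn_def by blast
  next
    case (inverse_coord c)
    show ?case by (rule exI[of _ "{c}"]) (simp add: depends_on_def)
  next
    case (add f g)
    then show ?case using depends_on_comb[of _ f _ g "(+)"] finite_UnI by metis
  next
    case (mult f g)
    then show ?case using depends_on_comb[of _ f _ g "(*)"] finite_UnI by metis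
  qed
  obtain g where g: "g \<in> gen" "agree f g" using assms unfolding represents_def by blast
  obtain S where S: "finite S" "depends_on S g" using *[OF g(1)] by blast
  have "pd c g = (\<lambda>p. 0)" if "c \<notin> S" for c
  proof (rule ext)
    fix p :: point
    have "g (p(c := s)) = g p" for s
      using that by (intro S(2)[unfolded depends_on_def, rule_format]) auto
    then show "pd c g p = 0" by (simp add: pd_def)
  qed
  then show ?thesis using S(1) pd_agree[OF g(2)] by metis
qed

text \<open>
  The algebra \<open>\<A>\<close>: two functions represent the same element if they agree on the dense open set
  where finitely many coordinates are nonzero.
\<close>

quotient_type alg = "point \<Rightarrow> real" / partial: "\<lambda>f g. represents f \<and> represents g \<and> agree f g"
proof (rule part_equivpI)
  show "\<exists>f. represents f \<and> represents f \<and> agree f f"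
    using gen_represents[OF gen.smooth[OF smooth_fn_const]] agree_refl by blast
  show "symp (\<lambda>f g. represents f \<and> represents g \<and> agree f g)"
    by (auto intro: sympI agree_sym)
  show "transp (\<lambda>f g. represents f \<and> represents g \<and> agree f g)"
    by (auto intro: transpI agree_trans)
qed

lemma represents_const: "represents (\<lambda>p. k)"
  by (intro gen_represents gen.smooth smooth_fn_const)

instantiation alg :: comm_ring_1
begin

lift_definition zero_alg :: alg is "\<lambda>p. 0" by (simp add: represents_const agree_refl)
lift_definition one_alg :: alg is "\<lambda>p. 1" by (simp add: represents_const agree_refl)
lift_definition plus_alg :: "alg \<Rightarrow> alg \<Rightarrow> alg" is "\<lambda>f g p. f p + g p"
  by (auto intro: represents_add agree_cong2)
lift_definition times_alg :: "alg \<Rightarrow> alg \<Rightarrow> alg" is "\<lambda>f g p. f p * g p"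
  by (auto intro: represents_mult agree_cong2)
lift_definition uminus_alg :: "alg \<Rightarrow> alg" is "\<lambda>f p. - f p"
  by (auto intro: represents_uminus agree_cong2[of _ _ _ _ "\<lambda>x y. - x"])
definition minus_alg :: "alg \<Rightarrow> alg \<Rightarrow> alg" where "minus_alg a b = a + - b"

instance
proof
  fix a b c :: alg
  show "a * b * c = a * (b * c)"
    by transfer (auto simp: mult.assoc intro!: represents_mult agree_refl)
  show "a * b = b * a"
    by transfer (auto simp: mult.commute intro!: represents_mult agree_refl)
  show "1 * a = a"
    by transfer (auto intro!: represents_mult represents_const agree_refl)
  show "a + b + c = a + (b + c)"
    by transfer (auto simp: add.assoc intro!: represents_add agree_refl)
  show "a + b = b + a"
    by transfer (auto simp: add.commute intro!: represents_add agree_refl)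
  show "0 + a = a"
    by transfer (auto intro!: represents_add represents_const agree_refl)
  show "- a + a = 0"
    by transfer (auto intro!: represents_const agree_refl)
  show "a - b = a + - b" by (simp add: minus_alg_def)
  show "(a + b) * c = a * c + b * c"
    by transfer (auto simp: distrib_right intro!: represents_add represents_mult agree_refl)
  show "(0::alg) \<noteq> 1"
  proof (transfer, clarsimp)
    assume "agree (\<lambda>p. 0) (\<lambda>p. 1)"
    then obtain S where "\<forall>p\<in>nonvanishing S. (0::real) = 1" unfolding agree_def by auto
    moreover have "(\<lambda>c. 1) \<in> nonvanishing S" by (simp add: nonvanishing_def)
    ultimately show False by auto
  qed
qed

end

instantiation alg :: real_algebra_1
begin

lift_definition scaleR_alg :: "real \<Rightarrow> alg \<Rightarrow> alg" is "\<lambda>k f p. k * f p"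
  by (auto intro!: represents_mult represents_const agree_cong2[of _ _ _ _ "(*)"] agree_refl)

instance
proof
  fix k l :: real and a b :: alg
  show "k *\<^sub>R (a + b) = k *\<^sub>R a + k *\<^sub>R b"
    by transfer (auto simp: distrib_left
        intro!: represents_add represents_mult represents_const agree_refl)
  show "(k + l) *\<^sub>R a = k *\<^sub>R a + l *\<^sub>R a"
    by transfer (auto simp: distrib_right
        intro!: represents_add represents_mult represents_const agree_refl)
  show "k *\<^sub>R l *\<^sub>R a = (k * l) *\<^sub>R a"
    by transfer (auto simp: mult.assoc intro!: represents_mult represents_const agree_refl)
  show "1 *\<^sub>R a = a"
    by transfer (auto simp: intro!: represents_mult represents_const agree_refl)
  show "k *\<^sub>R a * b = k *\<^sub>R (a * b)"
    by transfer (auto simp: mult.assoc intro!: represents_mult represents_const agree_refl)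
  show "a * k *\<^sub>R b = k *\<^sub>R (a * b)"
    by transfer (auto simp: mult.left_commute intro!: represents_mult represents_const agree_refl)
qed

end

text \<open>
  Quotients in \<open>\<A>\<close> are formed with the ring inverse of a unit; the inverse of a non-unit is
  the junk value 0.  Every internal coordinate is a unit.
\<close>

instantiation alg :: inverse
begin

definition inverse_alg :: "alg \<Rightarrow> alg" where
  "inverse_alg a = (if a dvd 1 then THE b. a * b = 1 else 0)"
definition divide_alg :: "alg \<Rightarrow> alg \<Rightarrow> alg" where
  "divide_alg a b = a * inverse b"

instance ..

end

lemma alg_inverse_unique:
  fixes a b :: alg assumes "a * b = 1" shows "inverse a = b"
proof -
  have "a dvd 1" using assms by (metis dvdI)
  moreover have "(THE b. a * b = 1) = b"
  proof (rule the_equality)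
    show "a * b = 1" by (rule assms)
  next
    fix c assume "a * c = 1"
    have "c = c * (a * b)" by (simp add: assms)
    also have "\<dots> = (a * c) * b" by (simp only: ac_simps)
    finally show "c = b" by (simp add: \<open>a * c = 1\<close>)
  qed
  ultimately show ?thesis by (simp add: inverse_alg_def)
qed

lift_definition coordinate :: "coord \<Rightarrow> alg" is "\<lambda>c p. p c"
  by (auto intro: gen_represents gen.smooth smooth_fn_coord agree_refl)

lift_definition inv_coordinate :: "coord \<Rightarrow> alg" is "\<lambda>c p. inverse (p c)"
  by (auto intro: gen_represents gen.inverse_coord agree_refl)

lemma coordinate_inv: "coordinate c * inv_coordinate c = 1"
proof (transfer, intro conjI)
  fix c
  show "agree (\<lambda>p. p c * inverse (p c)) (\<lambda>p. 1)"
    by (rule agreeI[of "{c}"]) (auto simp: nonvanishing_def)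
qed (intro gen_represents gen.mult gen.inverse_coord gen.smooth smooth_fn_coord smooth_fn_const)+

lemma inverse_coordinate: "inverse (coordinate c) = inv_coordinate c"
  by (rule alg_inverse_unique) (rule coordinate_inv)

lift_definition partial_deriv :: "coord \<Rightarrow> alg \<Rightarrow> alg" is pd
  by (auto intro: represents_pd pd_agree)

lemma partial_deriv_add: "partial_deriv c (a + b) = partial_deriv c a + partial_deriv c b"
proof transfer
  fix c f g
  assume "represents f \<and> represents f \<and> agree f f" "represents g \<and> represents g \<and> agree g g"
  then have fg: "represents f" "represents g" by auto
  then show "represents (pd c (\<lambda>p. f p + g p)) \<and> represents (\<lambda>p. pd c f p + pd c g p) \<and>
      agree (pd c (\<lambda>p. f p + g p)) (\<lambda>p. pd c f p + pd c g p)"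
    by (intro conjI represents_add represents_pd pd_add_agree represents_regular)
qed

lemma partial_deriv_mult:
  "partial_deriv c (a * b) = a * partial_deriv c b + partial_deriv c a * b"
proof transfer
  fix c f g
  assume "represents f \<and> represents f \<and> agree f f" "represents g \<and> represents g \<and> agree g g"
  then have fg: "represents f" "represents g" by auto
  have "represents (pd c f)" "represents (pd c g)" "represents (pd c (\<lambda>p. f p * g p))"
    using represents_pd[OF fg(1)] represents_pd[OF fg(2)] represents_pd[OF represents_mult[OF fg]]
    by auto
  then show "represents (pd c (\<lambda>p. f p * g p)) \<and>
      represents (\<lambda>p. f p * pd c g p + pd c f p * g p) \<and>
      agree (pd c (\<lambda>p. f p * g p)) (\<lambda>p. f p * pd c g p + pd c f p * g p)"
    using fg represents_add[OF represents_mult represents_mult]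
      pd_mult_agree[OF represents_regular represents_regular] by blast
qed

lemma partial_deriv_const: "partial_deriv c (k *\<^sub>R 1) = 0"
  by transfer (simp add: pd_const represents_const agree_refl)

lemma partial_deriv_coordinate: "partial_deriv d (coordinate c) = (if d = c then 1 else 0)"
  by transfer (simp add: pd_coord represents_const agree_refl)

lemma finite_partial_deriv: "finite {c. partial_deriv c a \<noteq> 0}"
proof -
  have "\<exists>S. finite S \<and> (\<forall>c. c \<notin> S \<longrightarrow> partial_deriv c a = 0)"
  proof transfer
    fix f assume "represents f \<and> represents f \<and> agree f f"
    then show "\<exists>S. finite S \<and>
        (\<forall>c. c \<notin> S \<longrightarrow> represents (pd c f) \<and> represents (\<lambda>p. 0) \<and> agree (pd c f) (\<lambda>p. 0))"
      using represents_finite[of f] represents_pd[of f] represents_const[of 0] by blast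
  qed
  then obtain S where "finite S" "\<forall>c. c \<notin> S \<longrightarrow> partial_deriv c a = 0" by blast
  then show ?thesis by (elim finite_subset[rotated]) auto
qed


section \<open>Vector fields\<close>

definition vf :: "(coord \<Rightarrow> alg) \<Rightarrow> alg \<Rightarrow> alg" where
  "vf V a = (\<Sum>c | partial_deriv c a \<noteq> 0. V c * partial_deriv c a)"

lemma vf_eq_sum:
  assumes "finite S" "{c. partial_deriv c a \<noteq> 0} \<subseteq> S"
  shows "vf V a = (\<Sum>c\<in>S. V c * partial_deriv c a)"
  unfolding vf_def using assms by (intro sum.mono_neutral_left) auto

lemma vf_add: "vf V (a + b) = vf V a + vf V b"
proof -
  let ?S = "{c. partial_deriv c a \<noteq> 0} \<union> {c. partial_deriv c b \<noteq> 0}"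
  have S: "finite ?S" by (simp add: finite_partial_deriv)
  have "vf V (a + b) = (\<Sum>c\<in>?S. V c * partial_deriv c (a + b))"
    by (rule vf_eq_sum[OF S]) (auto simp: partial_deriv_add)
  also have "\<dots> = (\<Sum>c\<in>?S. V c * partial_deriv c a) + (\<Sum>c\<in>?S. V c * partial_deriv c b)"
    by (simp add: partial_deriv_add distrib_left sum.distrib)
  also have "\<dots> = vf V a + vf V b"
    using vf_eq_sum[OF S, of a V] vf_eq_sum[OF S, of b V] by simp
  finally show ?thesis .
qed

lemma vf_mult: "vf V (a * b) = a * vf V b + vf V a * b"
proof -
  let ?S = "{c. partial_deriv c a \<noteq> 0} \<union> {c. partial_deriv c b \<noteq> 0}"
  have S: "finite ?S" by (simp add: finite_partial_deriv)
  have "vf V (a * b) = (\<Sum>c\<in>?S. V c * partial_deriv c (a * b))"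
    by (rule vf_eq_sum[OF S]) (auto simp: partial_deriv_mult)
  also have "\<dots> = a * (\<Sum>c\<in>?S. V c * partial_deriv c b) + (\<Sum>c\<in>?S. V c * partial_deriv c a) * b"
    by (simp add: partial_deriv_mult sum_distrib_left sum_distrib_right
        sum.distrib distrib_left ac_simps)
  also have "\<dots> = a * vf V b + vf V a * b"
    using vf_eq_sum[OF S, of a V] vf_eq_sum[OF S, of b V] by simp
  finally show ?thesis .
qed

lemma vf_const: "vf V (k *\<^sub>R 1) = 0"
  by (simp add: vf_def partial_deriv_const)

lemma vf_one: "vf V 1 = 0"
  using vf_const[of V 1] by simp

lemma vf_zero: "vf V 0 = 0"
  using vf_const[of V 0] by simp

lemma vf_uminus: "vf V (- a) = - vf V a"
  using vf_add[of V a "- a"] by (simp add: vf_zero minus_unique)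

lemma vf_diff: "vf V (a - b) = vf V a - vf V b"
  using vf_add[of V a "- b"] by (simp add: vf_uminus)

lemma vf_coordinate: "vf V (coordinate c) = V c"
proof -
  have "vf V (coordinate c) = (\<Sum>d\<in>{c}. V d * partial_deriv d (coordinate c))"
    by (rule vf_eq_sum) (auto simp: partial_deriv_coordinate)
  then show ?thesis by (simp add: partial_deriv_coordinate)
qed

lemma vf_inv_coordinate: "vf V (inv_coordinate c) = - (V c * inv_coordinate c * inv_coordinate c)"
proof -
  let ?i = "inv_coordinate c"
  have "0 = vf V (coordinate c * ?i)" by (simp add: coordinate_inv vf_one)
  also have "\<dots> = coordinate c * vf V ?i + V c * ?i" by (simp add: vf_mult vf_coordinate)
  finally have "0 * ?i = (coordinate c * vf V ?i + V c * ?i) * ?i" by simp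
  also have "\<dots> = (coordinate c * ?i) * vf V ?i + V c * ?i * ?i"
    by (simp only: distrib_right distrib_left ac_simps)
  finally have "vf V ?i + V c * ?i * ?i = 0" by (simp only: coordinate_inv mult_1 mult_zero_left)
  then show ?thesis by (rule eq_neg_iff_add_eq_0[THEN iffD2])
qed

inductive_set subalg :: "coord set \<Rightarrow> alg set" for S where
  "c \<in> S \<Longrightarrow> coordinate c \<in> subalg S"
| "c \<in> S \<Longrightarrow> inv_coordinate c \<in> subalg S"
| "0 \<in> subalg S"
| "1 \<in> subalg S"
| "a \<in> subalg S \<Longrightarrow> - a \<in> subalg S"
| "a \<in> subalg S \<Longrightarrow> b \<in> subalg S \<Longrightarrow> a + b \<in> subalg S"
| "a \<in> subalg S \<Longrightarrow> b \<in> subalg S \<Longrightarrow> a * b \<in> subalg S"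

lemma subalg_diff: "a \<in> subalg S \<Longrightarrow> b \<in> subalg S \<Longrightarrow> a - b \<in> subalg S"
  using subalg.intros(6)[OF _ subalg.intros(5), of a S b] by simp

lemma subalg_mono:
  assumes "a \<in> subalg S" "S \<subseteq> S'" shows "a \<in> subalg S'"
  using assms(1) by induction (simp_all add: subalg.intros subsetD[OF assms(2)])

lemma vf_cong:
  assumes "a \<in> subalg S" "\<And>c. c \<in> S \<Longrightarrow> V c = W c"
  shows "vf V a = vf W a"
  using assms(1)
  by induction (simp_all add: assms(2) vf_coordinate vf_inv_coordinate vf_zero vf_one vf_uminus
      vf_add vf_mult)

lemma vf_subalg:
  assumes "a \<in> subalg S" "\<And>c. c \<in> S \<Longrightarrow> V c \<in> subalg S"
  shows "vf V a \<in> subalg S"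
  using assms(1)
  by induction (simp_all add: vf_coordinate vf_inv_coordinate vf_zero vf_one vf_uminus vf_add
      vf_mult subalg.intros assms(2))

lemma funpow_vf_subalg:
  assumes "a \<in> subalg S" "\<And>c. c \<in> S \<Longrightarrow> V c \<in> subalg S"
  shows "(vf V ^^ n) a \<in> subalg S"
  using assms by (induction n) (auto intro: vf_subalg)

lemma funpow_vf_cong:
  assumes "a \<in> subalg S" "\<And>c. c \<in> S \<Longrightarrow> V c \<in> subalg S" "\<And>c. c \<in> S \<Longrightarrow> V c = W c"
  shows "(vf V ^^ n) a = (vf W ^^ n) a"
proof (induction n)
  case (Suc n)
  have "vf V ((vf V ^^ n) a) = vf W ((vf V ^^ n) a)"
    by (rule vf_cong[OF funpow_vf_subalg[of a S V]]) (auto intro: assms)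
  then show ?case using Suc by simp
qed simp

section \<open>Total derivatives\<close>

abbreviation "zz \<equiv> coordinate Cz"
abbreviation "tt \<equiv> coordinate Ct"
abbreviation "u_x \<equiv> coordinate (U 1 0)"
abbreviation "u_z \<equiv> coordinate (Uz 0 0 0)"
abbreviation "u_xx \<equiv> coordinate (U 2 0)"
abbreviation "u_xz \<equiv> coordinate (Uz 1 0 0)"
abbreviation "u_tx \<equiv> coordinate (U 1 1)"

definition GG :: alg where
  "GG = u_tx - u_z * u_xx + u_x * u_xz"

definition qq :: "nat \<Rightarrow> alg" where "qq \<alpha> = coordinate (Cq \<alpha> 0 0)"
definition mm :: "nat \<Rightarrow> alg" where "mm \<alpha> = coordinate (Cm \<alpha> 0 0)"
definition rr :: "nat \<Rightarrow> alg" where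
  "rr \<beta> = (case \<beta> of 0 \<Rightarrow> - coordinate (U 0 0) | Suc b \<Rightarrow> coordinate (Cr b 0 0))"

text \<open>The member with index \<open>\<alpha> - 1\<close> of a family whose member with index \<open>-1\<close> is zero.\<close>

definition prev :: "(nat \<Rightarrow> alg) \<Rightarrow> nat \<Rightarrow> alg" where
  "prev F \<alpha> = (case \<alpha> of 0 \<Rightarrow> 0 | Suc \<gamma> \<Rightarrow> F \<gamma>)"

text \<open>
  The values of the total derivatives on the coordinates refer to iterated total derivatives of
  functions of fewer families of coordinates.  To make this a definition, the total derivatives
  that just raise an index are collected first; the value 0 on the remaining coordinates is a
  placeholder which is never used.  The equations stated purely in terms of the resulting
  operators are proved below, from \<open>Dx_base\<close> to \<open>D_r\<close>.
\<close>

fun raise_x :: "coord \<Rightarrow> alg" where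
  "raise_x Cx = 1"
| "raise_x (U i j) = coordinate (U (i + 1) j)"
| "raise_x (Uy i k j) = coordinate (Uy (i + 1) k j)"
| "raise_x (Uz i l j) = coordinate (Uz (i + 1) l j)"
| "raise_x (Cq \<alpha> i j) = coordinate (Cq \<alpha> (i + 1) j)"
| "raise_x (Cm \<alpha> i j) = coordinate (Cm \<alpha> (i + 1) j)"
| "raise_x _ = 0"

fun raise_y :: "coord \<Rightarrow> alg" where
  "raise_y Cy = 1"
| "raise_y (U i j) = coordinate (Uy i 0 j)"
| "raise_y (Uy i k j) = coordinate (Uy i (k + 1) j)"
| "raise_y (Cr b i j) = coordinate (Cr b (i + 1) j)"
| "raise_y _ = 0"

fun raise_z :: "coord \<Rightarrow> alg" where
  "raise_z Cz = 1"
| "raise_z (U i j) = coordinate (Uz i 0 j)"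
| "raise_z (Uz i l j) = coordinate (Uz i (l + 1) j)"
| "raise_z (Cq \<alpha> i j) = coordinate (Cq \<alpha> i (j + 1))"
| "raise_z (Cm \<alpha> i j) = coordinate (Cm \<alpha> i (j + 1))"
| "raise_z _ = 0"

fun raise_t :: "coord \<Rightarrow> alg" where
  "raise_t Ct = 1"
| "raise_t (U i j) = coordinate (U i (j + 1))"
| "raise_t (Uy i k j) = coordinate (Uy i k (j + 1))"
| "raise_t (Uz i l j) = coordinate (Uz i l (j + 1))"
| "raise_t (Cr b i j) = coordinate (Cr b i (j + 1))"
| "raise_t _ = 0"

definition y_of_q :: "nat \<Rightarrow> alg" where
  "y_of_q \<alpha> = u_x * coordinate (Cq \<alpha> 1 0) + prev (\<lambda>\<gamma>. coordinate (Cq \<gamma> 1 0)) \<alpha>"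
definition t_of_q :: "nat \<Rightarrow> alg" where
  "t_of_q \<alpha> = u_z * coordinate (Cq \<alpha> 1 0) + prev (\<lambda>\<gamma>. coordinate (Cq \<gamma> 0 1)) \<alpha>"
definition y_of_m :: "nat \<Rightarrow> alg" where
  "y_of_m \<alpha> = u_x * coordinate (Cm \<alpha> 1 0) - zz / tt * coordinate (Cm \<alpha> 1 0)
     - 1 / tt * prev (\<lambda>\<gamma>. coordinate (Cm \<gamma> 1 0)) \<alpha>"
definition t_of_m :: "nat \<Rightarrow> alg" where
  "t_of_m \<alpha> = u_z * coordinate (Cm \<alpha> 1 0) - zz / tt * coordinate (Cm \<alpha> 0 1)
     - 1 / tt * prev (\<lambda>\<gamma>. coordinate (Cm \<gamma> 0 1)) \<alpha>"

fun Vy :: "coord \<Rightarrow> alg" where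
  "Vy (Uz i l j) = (vf raise_x ^^ i) ((vf raise_z ^^ l) ((vf raise_t ^^ j) GG))"
| "Vy (Cq \<alpha> i j) = (vf raise_x ^^ i) ((vf raise_z ^^ j) (y_of_q \<alpha>))"
| "Vy (Cm \<alpha> i j) = (vf raise_x ^^ i) ((vf raise_z ^^ j) (y_of_m \<alpha>))"
| "Vy c = raise_y c"

fun Vt :: "coord \<Rightarrow> alg" where
  "Vt (Cq \<alpha> i j) = (vf raise_x ^^ i) ((vf raise_z ^^ j) (t_of_q \<alpha>))"
| "Vt (Cm \<alpha> i j) = (vf raise_x ^^ i) ((vf raise_z ^^ j) (t_of_m \<alpha>))"
| "Vt c = raise_t c"

definition Dy :: "alg \<Rightarrow> alg" where "Dy = vf Vy"
definition Dt :: "alg \<Rightarrow> alg" where "Dt = vf Vt"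

primrec x_of_r :: "nat \<Rightarrow> alg" where
  "x_of_r 0 = - u_x"
| "x_of_r (Suc b) = u_x * x_of_r b - Dy (rr b)"

primrec z_of_r :: "nat \<Rightarrow> alg" where
  "z_of_r 0 = - u_z"
| "z_of_r (Suc b) = u_z * x_of_r b - Dt (rr b)"

fun Vx :: "coord \<Rightarrow> alg" where
  "Vx (Cr b i j) = (Dy ^^ i) ((Dt ^^ j) (x_of_r (b + 1)))"
| "Vx c = raise_x c"

fun Vz :: "coord \<Rightarrow> alg" where
  "Vz (Uy i k j) = (vf raise_x ^^ i) ((Dy ^^ k) ((vf raise_t ^^ j) GG))"
| "Vz (Cr b i j) = (Dy ^^ i) ((Dt ^^ j) (z_of_r (b + 1)))"
| "Vz c = raise_z c"

definition Dx :: "alg \<Rightarrow> alg" where "Dx = vf Vx"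
definition Dz :: "alg \<Rightarrow> alg" where "Dz = vf Vz"

lemmas D_defs = Dx_def Dy_def Dz_def Dt_def

lemma Dx_base:
  "Dx (coordinate Cx) = 1" "Dx (coordinate Cy) = 0" "Dx (coordinate Cz) = 0" "Dx (coordinate Ct) = 0"
  "Dx (coordinate (U i j)) = coordinate (U (i + 1) j)"
  "Dx (coordinate (Uy i k j)) = coordinate (Uy (i + 1) k j)"
  "Dx (coordinate (Uz i l j)) = coordinate (Uz (i + 1) l j)"
  "Dx (coordinate (Cq \<alpha> a b)) = coordinate (Cq \<alpha> (a + 1) b)"
  "Dx (coordinate (Cm \<alpha> a b)) = coordinate (Cm \<alpha> (a + 1) b)"
  by (simp_all add: D_defs vf_coordinate)

lemma Dy_base:
  "Dy (coordinate Cx) = 0" "Dy (coordinate Cy) = 1" "Dy (coordinate Cz) = 0" "Dy (coordinate Ct) = 0"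
  "Dy (coordinate (U i j)) = coordinate (Uy i 0 j)"
  "Dy (coordinate (Uy i k j)) = coordinate (Uy i (k + 1) j)"
  "Dy (coordinate (Cr \<beta> a b)) = coordinate (Cr \<beta> (a + 1) b)"
  by (simp_all add: D_defs vf_coordinate)

lemma Dz_base:
  "Dz (coordinate Cx) = 0" "Dz (coordinate Cy) = 0" "Dz (coordinate Cz) = 1" "Dz (coordinate Ct) = 0"
  "Dz (coordinate (U i j)) = coordinate (Uz i 0 j)"
  "Dz (coordinate (Uz i l j)) = coordinate (Uz i (l + 1) j)"
  "Dz (coordinate (Cq \<alpha> a b)) = coordinate (Cq \<alpha> a (b + 1))"
  "Dz (coordinate (Cm \<alpha> a b)) = coordinate (Cm \<alpha> a (b + 1))"
  by (simp_all add: D_defs vf_coordinate)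

lemma Dt_base:
  "Dt (coordinate Cx) = 0" "Dt (coordinate Cy) = 0" "Dt (coordinate Cz) = 0" "Dt (coordinate Ct) = 1"
  "Dt (coordinate (U i j)) = coordinate (U i (j + 1))"
  "Dt (coordinate (Uy i k j)) = coordinate (Uy i k (j + 1))"
  "Dt (coordinate (Uz i l j)) = coordinate (Uz i l (j + 1))"
  "Dt (coordinate (Cr \<beta> a b)) = coordinate (Cr \<beta> a (b + 1))"
  by (simp_all add: D_defs vf_coordinate)

text \<open>Families of coordinates closed under the operators used in the recursion.\<close>

definition fam_xzt :: "coord set" where
  "fam_xzt = {c. case c of Uy _ _ _ \<Rightarrow> False | Cq _ _ _ \<Rightarrow> False | Cm _ _ _ \<Rightarrow> False
     | Cr _ _ _ \<Rightarrow> False | _ \<Rightarrow> True}"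
definition fam_u :: "coord set" where
  "fam_u = {c. case c of Cq _ _ _ \<Rightarrow> False | Cm _ _ _ \<Rightarrow> False | Cr _ _ _ \<Rightarrow> False | _ \<Rightarrow> True}"
definition fam_qm :: "coord set" where
  "fam_qm = {c. case c of Uy _ _ _ \<Rightarrow> False | Cr _ _ _ \<Rightarrow> False | _ \<Rightarrow> True}"

lemmas fam_defs = fam_xzt_def fam_u_def fam_qm_def

lemma fam_xzt_closed:
  assumes "c \<in> fam_xzt"
  shows "raise_x c \<in> subalg fam_xzt" "raise_z c \<in> subalg fam_xzt" "raise_t c \<in> subalg fam_xzt"
  using assms by (cases c; auto simp: fam_defs intro!: subalg.intros)+

lemma fam_qm_closed:
  assumes "c \<in> fam_qm"
  shows "raise_x c \<in> subalg fam_qm" "raise_z c \<in> subalg fam_qm"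
  using assms by (cases c; auto simp: fam_defs intro!: subalg.intros)+

lemma GG_xzt: "GG \<in> subalg fam_xzt"
  unfolding GG_def by (intro subalg.intros subalg_diff) (auto simp: fam_defs)

lemma Vy_Uz_xzt: "Vy (Uz i l j) \<in> subalg fam_xzt"
  by (simp add: funpow_vf_subalg GG_xzt fam_xzt_closed)

lemma fam_u_closed:
  assumes "c \<in> fam_u"
  shows "raise_x c \<in> subalg fam_u" "Vy c \<in> subalg fam_u" "raise_t c \<in> subalg fam_u"
proof -
  show "raise_x c \<in> subalg fam_u" "raise_t c \<in> subalg fam_u"
    using assms by (cases c; auto simp: fam_defs intro!: subalg.intros)+
  have "fam_xzt \<subseteq> fam_u" by (auto simp: fam_defs split: coord.splits)
  then have "Vy (Uz i l j) \<in> subalg fam_u" for i l j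
    by (rule subalg_mono[OF Vy_Uz_xzt])
  then show "Vy c \<in> subalg fam_u"
    using assms by (cases c; auto simp: fam_u_def simp del: Vy.simps(1) intro!: subalg.intros)
qed

lemma raise_eq:
  "c \<in> fam_u \<union> fam_qm \<Longrightarrow> raise_x c = Vx c"
  "c \<in> fam_qm \<Longrightarrow> raise_z c = Vz c"
  "c \<in> fam_u \<Longrightarrow> raise_t c = Vt c"
  by (cases c; auto simp: fam_defs)+

lemma fam_xzt_subset: "c \<in> fam_xzt \<Longrightarrow> c \<in> fam_u \<and> c \<in> fam_qm"
  by (cases c) (auto simp: fam_defs)

lemma D_u:
  "Dy (coordinate (Uz i l j)) = (Dx ^^ i) ((Dz ^^ l) ((Dt ^^ j) GG))"
  "Dz (coordinate (Uy i k j)) = (Dx ^^ i) ((Dy ^^ k) ((Dt ^^ j) GG))"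
proof -
  have 1: "(vf raise_t ^^ j) GG = (Dt ^^ j) GG" unfolding Dt_def
    by (rule funpow_vf_cong[OF GG_xzt])
      (use fam_xzt_closed fam_xzt_subset raise_eq in auto)
  have 2: "(vf raise_t ^^ j) GG \<in> subalg fam_xzt"
    by (intro funpow_vf_subalg GG_xzt fam_xzt_closed)
  have 3: "(vf raise_z ^^ l) ((vf raise_t ^^ j) GG) = (Dz ^^ l) ((vf raise_t ^^ j) GG)"
    unfolding Dz_def
    by (rule funpow_vf_cong[OF 2]) (use fam_xzt_closed fam_xzt_subset raise_eq in auto)
  have 4: "(vf raise_z ^^ l) ((vf raise_t ^^ j) GG) \<in> subalg fam_xzt"
    by (intro funpow_vf_subalg 2 fam_xzt_closed)
  have "Vy (Uz i l j) = (Dx ^^ i) ((vf raise_z ^^ l) ((vf raise_t ^^ j) GG))"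
    unfolding Dx_def Vy.simps
    by (rule funpow_vf_cong[OF 4]) (use fam_xzt_closed fam_xzt_subset raise_eq in auto)
  then show "Dy (coordinate (Uz i l j)) = (Dx ^^ i) ((Dz ^^ l) ((Dt ^^ j) GG))"
    by (simp only: Dy_def vf_coordinate 3[unfolded 1] 1)
  have "(vf raise_t ^^ j) GG \<in> subalg fam_u"
    using fam_xzt_subset by (intro subalg_mono[OF 2]) auto
  then have 5: "(Dy ^^ k) ((vf raise_t ^^ j) GG) \<in> subalg fam_u"
    unfolding Dy_def by (rule funpow_vf_subalg) (rule fam_u_closed)
  have "Vz (Uy i k j) = (Dx ^^ i) ((Dy ^^ k) ((vf raise_t ^^ j) GG))"
    unfolding Dx_def Vz.simps
    by (rule funpow_vf_cong[OF 5]) (use fam_u_closed raise_eq in auto)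
  then show "Dz (coordinate (Uy i k j)) = (Dx ^^ i) ((Dy ^^ k) ((Dt ^^ j) GG))"
    unfolding Dz_def vf_coordinate 1 .
qed

lemma funpow_qm:
  assumes "a \<in> subalg fam_qm"
  shows "(vf raise_x ^^ i) ((vf raise_z ^^ j) a) = (Dx ^^ i) ((Dz ^^ j) a)"
proof -
  have 1: "(vf raise_z ^^ j) a = (Dz ^^ j) a" unfolding Dz_def
    by (rule funpow_vf_cong[OF assms]) (use fam_qm_closed raise_eq in auto)
  have 2: "(vf raise_z ^^ j) a \<in> subalg fam_qm"
    by (intro funpow_vf_subalg assms fam_qm_closed)
  have "(vf raise_x ^^ i) ((vf raise_z ^^ j) a) = (Dx ^^ i) ((vf raise_z ^^ j) a)"
    unfolding Dx_def by (rule funpow_vf_cong[OF 2]) (use fam_qm_closed raise_eq in auto)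
  then show ?thesis by (simp add: 1)
qed

lemma of_qm_subalg:
  "y_of_q \<alpha> \<in> subalg fam_qm" "t_of_q \<alpha> \<in> subalg fam_qm"
  "y_of_m \<alpha> \<in> subalg fam_qm" "t_of_m \<alpha> \<in> subalg fam_qm"
  unfolding y_of_q_def t_of_q_def y_of_m_def t_of_m_def divide_alg_def inverse_coordinate prev_def
  by (cases \<alpha>; simp; intro subalg.intros subalg_diff; simp add: fam_defs)+

lemma D_q:
  "Dy (coordinate (Cq \<alpha> a b)) = (Dx ^^ a) ((Dz ^^ b)
     (u_x * coordinate (Cq \<alpha> 1 0) + prev (\<lambda>\<gamma>. coordinate (Cq \<gamma> 1 0)) \<alpha>))"
  "Dt (coordinate (Cq \<alpha> a b)) = (Dx ^^ a) ((Dz ^^ b)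
     (u_z * coordinate (Cq \<alpha> 1 0) + prev (\<lambda>\<gamma>. coordinate (Cq \<gamma> 0 1)) \<alpha>))"
  unfolding Dy_def Dt_def vf_coordinate Vy.simps Vt.simps
    y_of_q_def[symmetric] t_of_q_def[symmetric]
  by (rule funpow_qm, rule of_qm_subalg)+

lemma D_m:
  "Dy (coordinate (Cm \<alpha> a b)) = (Dx ^^ a) ((Dz ^^ b)
     (u_x * coordinate (Cm \<alpha> 1 0) - zz / tt * coordinate (Cm \<alpha> 1 0)
       - 1 / tt * prev (\<lambda>\<gamma>. coordinate (Cm \<gamma> 1 0)) \<alpha>))"
  "Dt (coordinate (Cm \<alpha> a b)) = (Dx ^^ a) ((Dz ^^ b)
     (u_z * coordinate (Cm \<alpha> 1 0) - zz / tt * coordinate (Cm \<alpha> 0 1)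
       - 1 / tt * prev (\<lambda>\<gamma>. coordinate (Cm \<gamma> 0 1)) \<alpha>))"
  unfolding Dy_def Dt_def vf_coordinate Vy.simps Vt.simps
    y_of_m_def[symmetric] t_of_m_def[symmetric]
  by (rule funpow_qm, rule of_qm_subalg)+

lemma D_rr: "Dx (rr \<beta>) = x_of_r \<beta>" "Dz (rr \<beta>) = z_of_r \<beta>"
  by (cases \<beta>; simp add: rr_def D_defs vf_uminus vf_coordinate)+

lemma D_r:
  "Dx (coordinate (Cr b i j)) = (Dy ^^ i) ((Dt ^^ j) (u_x * Dx (rr b) - Dy (rr b)))"
  "Dz (coordinate (Cr b i j)) = (Dy ^^ i) ((Dt ^^ j) (u_z * Dx (rr b) - Dt (rr b)))"
  by (simp_all add: D_rr) (simp_all add: Dx_def Dz_def vf_coordinate)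

section \<open>Symmetries and recursion operators\<close>

text \<open>
  An element \<open>P = [p\<^sub>0, p\<^sub>0\<^sup>q, p\<^sub>0\<^sup>m, p\<^sub>1\<^sup>r, p\<^sub>1\<^sup>q, p\<^sub>1\<^sup>m, p\<^sub>2\<^sup>r, \<dots>]\<close> is a sequence \<open>nat \<Rightarrow> alg\<close>;
  the functions below select its entries, with \<open>p\<^sub>0\<^sup>r = - p\<^sub>0\<close>.
\<close>

definition pq :: "(nat \<Rightarrow> alg) \<Rightarrow> nat \<Rightarrow> alg" where "pq P \<alpha> = P (3 * \<alpha> + 1)"
definition pm :: "(nat \<Rightarrow> alg) \<Rightarrow> nat \<Rightarrow> alg" where "pm P \<alpha> = P (3 * \<alpha> + 2)"
definition pr :: "(nat \<Rightarrow> alg) \<Rightarrow> nat \<Rightarrow> alg" where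
  "pr P \<beta> = (if \<beta> = 0 then - P 0 else P (3 * \<beta>))"

definition seq_of :: "alg \<Rightarrow> (nat \<Rightarrow> alg) \<Rightarrow> (nat \<Rightarrow> alg) \<Rightarrow> (nat \<Rightarrow> alg) \<Rightarrow> nat \<Rightarrow> alg" where
  "seq_of p0 q m r n =
     (if n = 0 then p0
      else if n mod 3 = 0 then r (n div 3)
      else if n mod 3 = 1 then q (n div 3)
      else m (n div 3))"

lemma seq_of_select:
  "seq_of p0 q m r 0 = p0"
  "pq (seq_of p0 q m r) \<alpha> = q \<alpha>"
  "pm (seq_of p0 q m r) \<alpha> = m \<alpha>"
  "\<beta> \<ge> 1 \<Longrightarrow> pr (seq_of p0 q m r) \<beta> = r \<beta>"
proof -
  have "(3 * \<alpha> + 1) mod 3 = 1" "(3 * \<alpha> + 1) div 3 = \<alpha>"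
    "(3 * \<alpha> + 2) mod 3 = 2" "(3 * \<alpha> + 2) div 3 = \<alpha>" by presburger+
  then show "pq (seq_of p0 q m r) \<alpha> = q \<alpha>" "pm (seq_of p0 q m r) \<alpha> = m \<alpha>"
    unfolding pq_def pm_def seq_of_def by simp_all
qed (simp_all add: pr_def seq_of_def)

definition tau_sym :: "(nat \<Rightarrow> alg) set" where
  "tau_sym = {P.
     Dy (Dz (P 0)) - Dt (Dx (P 0)) + u_z * Dx (Dx (P 0)) - u_x * Dx (Dz (P 0))
       + u_xx * Dz (P 0) - u_xz * Dx (P 0) = 0 \<and>
     (\<forall>\<alpha>. Dt (pq P \<alpha>) - u_z * Dx (pq P \<alpha>) - Dx (qq \<alpha>) * Dz (P 0) - Dz (prev (pq P) \<alpha>) = 0) \<and>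
     (\<forall>\<alpha>. Dy (pq P \<alpha>) - u_x * Dx (pq P \<alpha>) - Dx (qq \<alpha>) * Dx (P 0) - Dx (prev (pq P) \<alpha>) = 0) \<and>
     (\<forall>\<alpha>. Dt (pm P \<alpha>) - u_z * Dx (pm P \<alpha>) - Dx (mm \<alpha>) * Dz (P 0)
        + zz / tt * Dz (pm P \<alpha>) + 1 / tt * Dz (prev (pm P) \<alpha>) = 0) \<and>
     (\<forall>\<alpha>. Dy (pm P \<alpha>) - u_x * Dx (pm P \<alpha>) - Dx (mm \<alpha>) * Dx (P 0)
        + zz / tt * Dx (pm P \<alpha>) + 1 / tt * Dx (prev (pm P) \<alpha>) = 0) \<and>
     Dx (pr P 1) - Dy (P 0) + 2 * u_x * Dx (P 0) = 0 \<and>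
     Dz (pr P 1) - Dt (P 0) + u_x * Dz (P 0) + u_z * Dx (P 0) = 0 \<and>
     (\<forall>\<beta>\<ge>2. Dx (pr P \<beta>) - u_x * Dx (pr P (\<beta> - 1)) - Dx (rr (\<beta> - 1)) * Dx (P 0)
        + Dy (pr P (\<beta> - 1)) = 0) \<and>
     (\<forall>\<beta>\<ge>2. Dz (pr P \<beta>) - u_z * Dx (pr P (\<beta> - 1)) - Dx (rr (\<beta> - 1)) * Dz (P 0)
        + Dt (pr P (\<beta> - 1)) = 0)}"

definition real_linear :: "((nat \<Rightarrow> alg) \<Rightarrow> (nat \<Rightarrow> alg)) \<Rightarrow> bool" where
  "real_linear R \<longleftrightarrow>
     (\<forall>P Q. R (\<lambda>n. P n + Q n) = (\<lambda>n. R P n + R Q n)) \<and>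
     (\<forall>k P. R (\<lambda>n. k *\<^sub>R P n) = (\<lambda>n. k *\<^sub>R R P n))"

definition module_endomorphism :: "((nat \<Rightarrow> alg) \<Rightarrow> (nat \<Rightarrow> alg)) \<Rightarrow> bool" where
  "module_endomorphism R \<longleftrightarrow>
     (\<forall>P Q. R (\<lambda>n. P n + Q n) = (\<lambda>n. R P n + R Q n)) \<and>
     (\<forall>a P. R (\<lambda>n. a * P n) = (\<lambda>n. a * R P n))"

definition recursion_operator :: "((nat \<Rightarrow> alg) \<Rightarrow> (nat \<Rightarrow> alg)) \<Rightarrow> bool" where
  "recursion_operator R \<longleftrightarrow> real_linear R \<and> (\<forall>P\<in>tau_sym. R P \<in> tau_sym)"

definition Rq :: "(nat \<Rightarrow> alg) \<Rightarrow> (nat \<Rightarrow> alg)" where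
  "Rq P = seq_of
     (u_x * P 0 + pr P 1)
     (\<lambda>\<alpha>. Dx (qq \<alpha>) * P 0 + prev (pq P) \<alpha>)
     (\<lambda>\<alpha>. Dx (mm \<alpha>) * P 0 - 1 / tt * prev (pm P) \<alpha> - zz / tt * pm P \<alpha>)
     (\<lambda>\<beta>. Dx (rr \<beta>) * P 0 - pr P (\<beta> + 1))"

definition Rm :: "(nat \<Rightarrow> alg) \<Rightarrow> (nat \<Rightarrow> alg)" where
  "Rm P = (\<lambda>n. tt * Rq P n + zz * P n)"

end

theory Submission
  imports Defs
begin

text \<open>
  If \<open>Q = R\<^sup>q(P)\<close>, then each residual of the equations (NS2)--(NS9) at \<open>Q\<close> is a combination of the
  residuals at \<open>P\<close> and of the two defects
  \<open>D\<^sub>t p\<^sub>0 - u\<^sub>z D\<^sub>x p\<^sub>0 + u\<^sub>x\<^sub>z p\<^sub>0 - D\<^sub>z Q\<^sub>0\<close> and \<open>D\<^sub>y p\<^sub>0 - u\<^sub>x D\<^sub>x p\<^sub>0 + u\<^sub>x\<^sub>x p\<^sub>0 - D\<^sub>x Q\<^sub>0\<close>,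
  where \<open>p\<^sub>0\<close>, \<open>Q\<^sub>0\<close> are the first entries, and the first \<open>q\<close>-residual is a unit
  times a defect.  So if \<open>Q\<close> is a symmetry, the defects vanish, and
  then the residuals at \<open>P\<close> vanish by induction on the index.  Equation (NS1) for \<open>p\<^sub>0\<close> is the
  compatibility condition \<open>D\<^sub>x D\<^sub>z Q\<^sub>0 = D\<^sub>z D\<^sub>x Q\<^sub>0\<close> of the two vanishing defects.  For \<open>R\<^sup>m\<close>
  the same works with the first \<open>m\<close>-residual.
  All this rests on the commutation of the total derivatives on \<open>\<A>\<close>, which is checked on the
  coordinates and carries over to smooth functions because second derivatives are symmetric.
\<close>

section \<open>Symmetry of second derivatives\<close>

lemma smooth_fn_has_pd:
  assumes "smooth_fn f"
  shows "((\<lambda>s. f (p(c := s))) has_real_derivative pd c f (p(c := s))) (at s)"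
proof -
  have "differentiable_in c (foldr pd [] f) (p(c := s))"
    using assms unfolding smooth_fn_def by blast
  then show ?thesis
    unfolding differentiable_in_def pd_def
    by (simp add: DERIV_deriv_iff_field_differentiable)
qed

lemma smooth_fn_continuous: "smooth_fn f \<Longrightarrow> continuous_on UNIV f"
  unfolding smooth_fn_def by (metis foldr.simps(1) id_apply)

text \<open>The mean value theorem is applied twice: in direction \<open>c\<close> to the increment
  of \<open>f\<close> in direction \<open>d\<close>, then in direction \<open>d\<close> to
  \<open>pd c f\<close>. The second difference is symmetric in \<open>c\<close> and
  \<open>d\<close>, so exchanging them yields the other mixed derivative.\<close>

lemma second_difference:
  assumes f: "smooth_fn f" and cd: "c \<noteq> d" and h: "h > 0"
  shows "\<exists>s t. 0 < s \<and> s < h \<and> 0 < t \<and> t < h \<and>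
    f (p(c := p c + h, d := p d + h)) - f (p(c := p c + h)) - f (p(d := p d + h)) + f p
      = h * h * pd d (pd c f) (p(c := p c + s, d := p d + t))"
proof -
  define \<phi> where "\<phi> s = f (p(d := p d + h, c := s)) - f (p(c := s))" for s
  define \<phi>' where "\<phi>' s = pd c f (p(d := p d + h, c := s)) - pd c f (p(c := s))" for s
  have "\<exists>s. p c < s \<and> s < p c + h \<and> \<phi> (p c + h) - \<phi> (p c) = (p c + h - p c) * \<phi>' s"
    by (rule MVT2) (use h in \<open>auto simp: \<phi>_def \<phi>'_def intro!: derivative_intros smooth_fn_has_pd[OF f]\<close>)
  then obtain s where s: "p c < s" "s < p c + h" "\<phi> (p c + h) - \<phi> (p c) = h * \<phi>' s" by auto
  have "\<exists>t. p d < t \<and> t < p d + h \<and> pd c f (p(c := s, d := p d + h)) - pd c f (p(c := s, d := p d))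
      = (p d + h - p d) * pd d (pd c f) (p(c := s, d := t))"
    by (rule MVT2) (use h in \<open>simp_all only: less_add_same_cancel1 smooth_fn_has_pd[OF smooth_fn_pd[OF f]]\<close>)
  then obtain t where t: "p d < t" "t < p d + h"
    "pd c f (p(c := s, d := p d + h)) - pd c f (p(c := s, d := p d)) = h * pd d (pd c f) (p(c := s, d := t))"
    by auto
  have "p(c := s, d := p d) = p(c := s)" "p(d := p d + h, c := s) = p(c := s, d := p d + h)"
    "p(d := p d + h, c := p c) = p(d := p d + h)"
    "p(d := p d + h, c := p c + h) = p(c := p c + h, d := p d + h)" using cd by auto
  with s(3) t(3) have "f (p(c := p c + h, d := p d + h)) - f (p(c := p c + h)) - f (p(d := p d + h)) + f p
      = h * h * pd d (pd c f) (p(c := p c + (s - p c), d := p d + (t - p d)))"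
    by (simp add: \<phi>_def \<phi>'_def)
  then show ?thesis using s t by (intro exI[of _ "s - p c"] exI[of _ "t - p d"]) auto
qed

text \<open>For each h > 0 both mixed derivatives, each taken at a point near \<open>p\<close>,
  equal the same second difference divided by h^2. Continuity gives equality at \<open>p\<close> as
  h tends to 0.\<close>

lemma pd_commute:
  assumes f: "smooth_fn f" shows "pd c (pd d f) = pd d (pd c f)"
proof (cases "c = d")
  case False
  show ?thesis
  proof (rule ext)
    fix p
    \<comment> \<open>A plane through \<open>p\<close>, so that convergence to \<open>p\<close> can
      be measured by a norm.\<close>
    define P where "P z = p(c := p c + fst z, d := p d + snd z)" for z :: "real \<times> real"
    have P0: "P (0, 0) = p" by (simp add: P_def)
    have contP: "continuous_on UNIV P"
    proof (rule continuous_on_coordinatewise_then_product)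
      show "continuous_on UNIV (\<lambda>z. P z e)" for e
        using False by (cases "e = c"; cases "e = d") (auto simp: P_def intro!: continuous_intros)
    qed
    have cont: "isCont (\<lambda>z. F (P z)) (0, 0)" if "smooth_fn F" for F
      using continuous_on_compose2[OF smooth_fn_continuous[OF that] contP]
      by (simp add: continuous_on_eq_continuous_at)
    have "\<exists>z z'. norm z \<le> 2 * h \<and> norm z' \<le> 2 * h \<and> pd d (pd c f) (P z) = pd c (pd d f) (P z')"
      if "h > 0" for h
    proof -
      have nrm: "norm (s, t) \<le> 2 * h" if "0 < s" "s < h" "0 < t" "t < h" for s t :: real
        using norm_Pair_le[of s t] that by simp
      obtain s t where st: "0 < s" "s < h" "0 < t" "t < h"
        "f (p(c := p c + h, d := p d + h)) - f (p(c := p c + h)) - f (p(d := p d + h)) + f p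
          = h * h * pd d (pd c f) (P (s, t))"
        using second_difference[OF f False \<open>h > 0\<close>, of p] by (auto simp: P_def)
      \<comment> \<open>With the roles exchanged, \<open>s'\<close> is the increment in direction
        \<open>d\<close> and \<open>t'\<close> the one in direction \<open>c\<close>; the point
        reached is \<open>P (t', s')\<close>.\<close>
      obtain s' t' where st': "0 < s'" "s' < h" "0 < t'" "t' < h"
        "f (p(d := p d + h, c := p c + h)) - f (p(d := p d + h)) - f (p(c := p c + h)) + f p
          = h * h * pd c (pd d f) (p(d := p d + s', c := p c + t'))"
        using second_difference[OF f False[symmetric] \<open>h > 0\<close>, of p] by blast
      have "p(d := p d + s', c := p c + t') = P (t', s')"
        "p(d := p d + h, c := p c + h) = p(c := p c + h, d := p d + h)"
        using False by (auto simp: P_def)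
      note st'(5)[unfolded this]
      then have "h * h * pd d (pd c f) (P (s, t)) = h * h * pd c (pd d f) (P (t', s'))"
        unfolding st(5)[symmetric] by simp
      then have "pd d (pd c f) (P (s, t)) = pd c (pd d f) (P (t', s'))" using \<open>h > 0\<close> by simp
      then show ?thesis using nrm st st' by blast
    qed
    then have "\<forall>n. \<exists>z z'. norm z \<le> 2 * inverse (real (Suc n)) \<and> norm z' \<le> 2 * inverse (real (Suc n)) \<and>
        pd d (pd c f) (P z) = pd c (pd d f) (P z')" by simp
    then obtain z z' where z: "\<And>n. norm (z n) \<le> 2 * inverse (real (Suc n))"
      "\<And>n. norm (z' n) \<le> 2 * inverse (real (Suc n))"
      "\<And>n. pd d (pd c f) (P (z n)) = pd c (pd d f) (P (z' n))" by metis
    have lim: "(\<lambda>n. 2 * inverse (real (Suc n))) \<longlonglongrightarrow> 0"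
      using tendsto_mult_right_zero[OF LIMSEQ_inverse_real_of_nat] by blast
    have "z \<longlonglongrightarrow> (0, 0)" "z' \<longlonglongrightarrow> (0, 0)"
      unfolding zero_prod_def[symmetric]
      by (rule Lim_null_comparison[OF _ lim], simp add: z del: of_nat_Suc)+
    then have "(\<lambda>n. pd d (pd c f) (P (z n))) \<longlonglongrightarrow> pd d (pd c f) p"
      "(\<lambda>n. pd c (pd d f) (P (z' n))) \<longlonglongrightarrow> pd c (pd d f) p"
      using isCont_tendsto_compose[OF cont[of "pd d (pd c f)"]]
        isCont_tendsto_compose[OF cont[of "pd c (pd d f)"]] P0 f
      by (auto simp: smooth_fn_pd)
    then show "pd c (pd d f) p = pd d (pd c f) p"
      unfolding z(3) by (rule LIMSEQ_unique[symmetric])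
  qed
qed simp

section \<open>Commutation of partial derivatives on the algebra\<close>

lemma partial_deriv_zero: "partial_deriv c 0 = 0"
  using partial_deriv_const[of c 0] by simp

lemma partial_deriv_one: "partial_deriv c 1 = 0"
  using partial_deriv_const[of c 1] by simp

lemma partial_deriv_uminus: "partial_deriv c (- a) = - partial_deriv c a"
  using partial_deriv_add[of c a "- a"] by (simp add: partial_deriv_zero minus_unique)

lemma partial_deriv_inv_coordinate:
  "partial_deriv d (inv_coordinate c)
     = (if d = c then - (inv_coordinate c * inv_coordinate c) else 0)"
proof -
  let ?i = "inv_coordinate c"
  have "0 = partial_deriv d (coordinate c * ?i)" by (simp add: coordinate_inv partial_deriv_one)
  also have "\<dots> = coordinate c * partial_deriv d ?i + (if d = c then ?i else 0)"
    by (simp add: partial_deriv_mult partial_deriv_coordinate)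
  finally have "0 = (coordinate c * partial_deriv d ?i + (if d = c then ?i else 0)) * ?i" by simp
  also have "\<dots> = (coordinate c * ?i) * partial_deriv d ?i + (if d = c then ?i * ?i else 0)"
    by (simp add: algebra_simps)
  finally show ?thesis by (auto simp: coordinate_inv eq_neg_iff_add_eq_0)
qed

text \<open>Every element has a representative in \<open>gen\<close>, and induction over its
  construction reduces the claim to \<open>pd_commute\<close> and to inverse coordinates; for a
  product, the mixed terms of the Leibniz rule are exchanged.\<close>

lemma partial_deriv_commute:
  "partial_deriv c (partial_deriv d a) = partial_deriv d (partial_deriv c a)"
proof -
  have *: "partial_deriv c (partial_deriv d (abs_alg f)) = partial_deriv d (partial_deriv c (abs_alg f))"
    if "f \<in> gen" for f
    using that
  proof (induction rule: gen.induct)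
    case (smooth f)
    then have "represents f" by (intro gen_represents gen.smooth)
    then show ?case
      by (simp add: partial_deriv.abs_eq agree_refl represents_pd pd_commute[OF smooth])
  next
    case (inverse_coord e)
    have "abs_alg (\<lambda>p. inverse (p e)) = inv_coordinate e"
      by (simp add: inv_coordinate.abs_eq)
    then show ?case
      by (simp add: partial_deriv_inv_coordinate partial_deriv_mult partial_deriv_uminus
          partial_deriv_zero)
  next
    case (add f g)
    then have "abs_alg (\<lambda>p. f p + g p) = abs_alg f + abs_alg g"
      by (simp add: plus_alg.abs_eq gen_represents agree_refl)
    then show ?case by (simp add: partial_deriv_add add)
  next
    case (mult f g)
    then have "abs_alg (\<lambda>p. f p * g p) = abs_alg f * abs_alg g"
      by (simp add: times_alg.abs_eq gen_represents agree_refl)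
    then show ?case by (simp add: partial_deriv_add partial_deriv_mult mult algebra_simps)
  qed
  have "\<exists>f. represents f \<and> a = abs_alg f"
    by (rule alg.abs_induct) blast
  then obtain f where f: "represents f" "a = abs_alg f" by blast
  then obtain g where g: "g \<in> gen" "agree f g" unfolding represents_def by blast
  have "a = abs_alg g"
    unfolding f(2) by (rule Quotient3_rel_abs[OF Quotient3_alg]) (simp add: f(1) g gen_represents)
  then show ?thesis using *[OF g(1)] by simp
qed

section \<open>Commuting vector fields\<close>

lemma vf_sum: "finite S \<Longrightarrow> vf V (\<Sum>c\<in>S. f c) = (\<Sum>c\<in>S. vf V (f c))"
  by (induction rule: finite_induct) (simp_all add: vf_zero vf_add)

text \<open>The set \<open>S\<close> serves for \<open>partial_deriv d a\<close> too: a derivative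
  in a direction outside \<open>S\<close> may be taken first, and it kills \<open>a\<close>.\<close>

lemma vf_partial_deriv:
  assumes "finite S" "{c. partial_deriv c a \<noteq> 0} \<subseteq> S"
  shows "vf V (partial_deriv d a) = (\<Sum>c\<in>S. V c * partial_deriv d (partial_deriv c a))"
proof -
  have "vf V (partial_deriv d a) = (\<Sum>c\<in>S. V c * partial_deriv c (partial_deriv d a))"
    by (rule vf_eq_sum[OF assms(1)])
      (use assms(2) in \<open>auto simp: partial_deriv_commute[of _ d] partial_deriv_zero\<close>)
  then show ?thesis by (simp add: partial_deriv_commute[of _ d])
qed

lemma vf_vf:
  assumes "finite S" "{c. partial_deriv c a \<noteq> 0} \<subseteq> S"
  shows "vf V (vf W a) = (\<Sum>c\<in>S. vf V (W c) * partial_deriv c a)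
    + (\<Sum>d\<in>S. \<Sum>c\<in>S. W d * V c * partial_deriv d (partial_deriv c a))"
  using assms
  by (simp add: vf_eq_sum[OF assms, of W] vf_sum vf_mult vf_partial_deriv[OF assms] sum.distrib
      sum_distrib_left mult.assoc add.commute)

text \<open>The second-order parts of the two compositions agree, so the commutator is again a
  vector field, determined by its values on coordinates. This argument also reaches the smooth
  functions in the algebra.\<close>

lemma vf_commute:
  assumes "\<And>c. vf V (W c) = vf W (V c)"
  shows "vf V (vf W a) = vf W (vf V a)"
proof -
  let ?S = "{c. partial_deriv c a \<noteq> 0}"
  have "(\<Sum>d\<in>?S. \<Sum>c\<in>?S. W d * V c * partial_deriv d (partial_deriv c a))
      = (\<Sum>c\<in>?S. \<Sum>d\<in>?S. W d * V c * partial_deriv d (partial_deriv c a))"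
    by (rule sum.swap)
  also have "\<dots> = (\<Sum>c\<in>?S. \<Sum>d\<in>?S. V c * W d * partial_deriv c (partial_deriv d a))"
    by (simp add: partial_deriv_commute mult.commute)
  finally show ?thesis
    by (simp add: vf_vf[OF finite_partial_deriv subset_refl] assms)
qed

text \<open>A commutator of derivations is a derivation, so it vanishes on all that the coordinates
  in \<open>S\<close> and their inverses generate. Only values on \<open>S\<close> enter, which lets
  commutation be proved family by family.\<close>

lemma vf_commute_subalg:
  assumes "\<And>c. c \<in> S \<Longrightarrow> vf V (W c) = vf W (V c)" "a \<in> subalg S"
  shows "vf V (vf W a) = vf W (vf V a)"
  using assms(2)
  by induction
    (simp_all add: assms(1) vf_coordinate vf_inv_coordinate vf_zero vf_one vf_uminus vf_add vf_mult
      algebra_simps)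

text \<open>Only \<open>W\<close> has to preserve \<open>S\<close>: \<open>V\<close> is moved past
  one factor at a time, and every argument it meets lies in \<open>subalg S\<close>.\<close>

lemma vf_funpow_commute:
  assumes "\<And>c. c \<in> S \<Longrightarrow> vf V (W c) = vf W (V c)" "\<And>c. c \<in> S \<Longrightarrow> W c \<in> subalg S" "a \<in> subalg S"
  shows "vf V ((vf W ^^ n) a) = (vf W ^^ n) (vf V a)"
proof (induction n)
  case (Suc n)
  have "vf V (vf W ((vf W ^^ n) a)) = vf W (vf V ((vf W ^^ n) a))"
    by (rule vf_commute_subalg[OF assms(1) funpow_vf_subalg]) (use assms in auto)
  then show ?case using Suc by simp
qed simp

text \<open>These predicates hide the coefficient functions, so that the results above apply to
  \<open>Dx\<close>, \<open>Dy\<close>, \<open>Dz\<close>, \<open>Dt\<close> by name.\<close>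

definition vector_field :: "(alg \<Rightarrow> alg) \<Rightarrow> bool" where
  "vector_field D \<longleftrightarrow> (\<exists>V. D = vf V)"

definition preserves :: "coord set \<Rightarrow> (alg \<Rightarrow> alg) \<Rightarrow> bool" where
  "preserves S D \<longleftrightarrow> (\<forall>c\<in>S. D (coordinate c) \<in> subalg S)"

definition commute_on :: "coord set \<Rightarrow> (alg \<Rightarrow> alg) \<Rightarrow> (alg \<Rightarrow> alg) \<Rightarrow> bool" where
  "commute_on S D E \<longleftrightarrow> (\<forall>c\<in>S. D (E (coordinate c)) = E (D (coordinate c)))"

lemma commute_on_sym: "commute_on S D E \<Longrightarrow> commute_on S E D"
  by (simp add: commute_on_def)

lemma vector_field_D: "vector_field Dx" "vector_field Dy" "vector_field Dz" "vector_field Dt"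
  by (auto simp: vector_field_def D_defs)

lemma preserves_funpow:
  assumes "vector_field D" "preserves S D" "a \<in> subalg S"
  shows "(D ^^ n) a \<in> subalg S"
  using assms by (auto simp: vector_field_def preserves_def vf_coordinate intro!: funpow_vf_subalg)

lemma preserves_subalg:
  "vector_field D \<Longrightarrow> preserves S D \<Longrightarrow> a \<in> subalg S \<Longrightarrow> D a \<in> subalg S"
  using preserves_funpow[of D S a 1] by simp

lemma commute_on_funpow:
  assumes "vector_field D" "vector_field E" "commute_on S D E" "preserves S E" "a \<in> subalg S"
  shows "D ((E ^^ n) a) = (E ^^ n) (D a)"
proof -
  obtain V W where "D = vf V" "E = vf W" using assms by (auto simp: vector_field_def)
  then show ?thesis
    using assms vf_funpow_commute[of S V W a n]
    by (auto simp: preserves_def commute_on_def vf_coordinate)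
qed

lemma commute_on_subalg:
  assumes "vector_field D" "vector_field E" "commute_on S D E" "a \<in> subalg S"
  shows "D (E a) = E (D a)"
  using assms vf_commute_subalg[of S _ _ a]
  by (auto simp: vector_field_def commute_on_def vf_coordinate)

lemma commute_on_UNIV:
  assumes "vector_field D" "vector_field E" "commute_on UNIV D E"
  shows "D (E a) = E (D a)"
  using assms vf_commute[of _ _ a] by (auto simp: vector_field_def commute_on_def vf_coordinate)

lemma vector_field_rules:
  assumes "vector_field D"
  shows "D 0 = 0" "D 1 = 0" "D (- a) = - D a" "D (a + b) = D a + D b" "D (a - b) = D a - D b"
    "D (a * b) = a * D b + D a * b"
    "D (inv_coordinate c) = - (D (coordinate c) * inv_coordinate c * inv_coordinate c)"
  using assms
  by (auto simp: vector_field_def vf_zero vf_one vf_uminus vf_add vf_diff vf_mult vf_coordinate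
      vf_inv_coordinate)

lemmas D_rules = vector_field_rules[OF vector_field_D(1)] vector_field_rules[OF vector_field_D(2)]
  vector_field_rules[OF vector_field_D(3)] vector_field_rules[OF vector_field_D(4)]
lemmas D_base = Dx_base Dy_base Dz_base Dt_base

section \<open>Commutation on the coordinates of \<open>u\<close>\<close>

lemma preserves_xzt: "preserves fam_xzt Dx" "preserves fam_xzt Dz" "preserves fam_xzt Dt"
  unfolding preserves_def
  by (intro ballI, rename_tac c, case_tac c; simp add: D_base fam_defs subalg.intros)+

lemma Dy_Uz_xzt: "Dy (coordinate (Uz i l j)) \<in> subalg fam_xzt"
  unfolding D_u by (intro preserves_funpow vector_field_D preserves_xzt GG_xzt)

lemma xzt_subalg_u: "a \<in> subalg fam_xzt \<Longrightarrow> a \<in> subalg fam_u"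
  by (erule subalg_mono) (use fam_xzt_subset in auto)

lemma preserves_u: "preserves fam_u Dx" "preserves fam_u Dy" "preserves fam_u Dz" "preserves fam_u Dt"
proof -
  show x: "preserves fam_u Dx" and t: "preserves fam_u Dt"
    unfolding preserves_def
    by (intro ballI, rename_tac c, case_tac c; simp add: D_base fam_defs subalg.intros)+
  show y: "preserves fam_u Dy"
    unfolding preserves_def
  proof
    fix c assume "c \<in> fam_u" then show "Dy (coordinate c) \<in> subalg fam_u"
      using xzt_subalg_u[OF Dy_Uz_xzt] by (cases c) (simp_all add: D_base fam_u_def subalg.intros)
  qed
  \<comment> \<open>\<open>Dz\<close> comes last: on \<open>Uy\<close> it is given by powers of
    \<open>Dx\<close>, \<open>Dy\<close>, \<open>Dt\<close> applied to \<open>GG\<close>, and these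
    three already preserve the family.\<close>
  have "Dz (coordinate (Uy i k j)) \<in> subalg fam_u" for i k j
    unfolding D_u by (intro preserves_funpow vector_field_D x y t xzt_subalg_u GG_xzt)
  then show "preserves fam_u Dz"
    unfolding preserves_def
    by (intro ballI, rename_tac c, case_tac c; simp add: D_base fam_u_def subalg.intros)
qed

lemma commute_xzt: "commute_on fam_xzt Dx Dz" "commute_on fam_xzt Dx Dt" "commute_on fam_xzt Dz Dt"
  unfolding commute_on_def
  by (intro ballI, rename_tac c, case_tac c; simp add: D_base D_rules fam_defs)+

text \<open>The order of the pairs matters. \<open>Dx\<close> just adds one more outer
  \<open>Dx\<close> in \<open>D_u\<close>; every other pair requires moving an operator past the
  powers in \<open>D_u\<close>, which uses pairs treated before or the smaller family
  \<open>fam_xzt\<close>.\<close>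

lemma commute_u:
  "commute_on fam_u Dx Dy" "commute_on fam_u Dx Dz" "commute_on fam_u Dx Dt"
  "commute_on fam_u Dy Dz" "commute_on fam_u Dy Dt" "commute_on fam_u Dz Dt"
proof -
  note pow = commute_on_funpow[OF vector_field_D(3) vector_field_D(1)]
    commute_on_funpow[OF vector_field_D(4) vector_field_D(1)]
    commute_on_funpow[OF vector_field_D(2) vector_field_D(1)]
    commute_on_funpow[OF vector_field_D(4) vector_field_D(2)]
    commute_on_funpow[OF vector_field_D(4) vector_field_D(3)]
  note GG_u = xzt_subalg_u[OF GG_xzt]
  note mem = preserves_funpow vector_field_D preserves_xzt preserves_u GG_xzt GG_u
  show xy: "commute_on fam_u Dx Dy" and xz: "commute_on fam_u Dx Dz" and xt: "commute_on fam_u Dx Dt"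
    unfolding commute_on_def
    by (intro ballI, rename_tac c, case_tac c; simp add: D_base D_rules D_u fam_u_def)+
  have "Dt ((Dx ^^ i) ((Dz ^^ l) ((Dt ^^ j) GG))) = (Dx ^^ i) ((Dz ^^ l) (Dt ((Dt ^^ j) GG)))" for i l j
    by (simp add: pow(2)[OF commute_on_sym[OF commute_xzt(2)]] pow(5)[OF commute_on_sym[OF commute_xzt(3)]] mem)
  then show yt: "commute_on fam_u Dy Dt"
    unfolding commute_on_def
    by (intro ballI, rename_tac c, case_tac c; simp add: D_base D_rules D_u fam_u_def)
  have "Dt ((Dx ^^ i) ((Dy ^^ k) ((Dt ^^ j) GG))) = (Dx ^^ i) ((Dy ^^ k) (Dt ((Dt ^^ j) GG)))" for i k j
    by (simp add: pow(2)[OF commute_on_sym[OF xt]] pow(4)[OF commute_on_sym[OF yt]] mem)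
  then show "commute_on fam_u Dz Dt"
    unfolding commute_on_def
    by (intro ballI, rename_tac c, case_tac c; simp add: D_base D_rules D_u fam_u_def)
  have "Dz ((Dx ^^ i) ((Dz ^^ l) ((Dt ^^ j) GG))) = (Dx ^^ i) (Dz ((Dz ^^ l) ((Dt ^^ j) GG)))"
    "Dy ((Dx ^^ i) ((Dy ^^ l) ((Dt ^^ j) GG))) = (Dx ^^ i) (Dy ((Dy ^^ l) ((Dt ^^ j) GG)))" for i l j
    by (simp_all add: pow(1)[OF commute_on_sym[OF commute_xzt(1)]] pow(3)[OF commute_on_sym[OF xy]] mem)
  then show "commute_on fam_u Dy Dz"
    unfolding commute_on_def
    by (intro ballI, rename_tac c, case_tac c; simp add: D_base D_rules D_u fam_u_def)
qed

section \<open>Commutation on the coordinates of the coverings\<close>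

lemma preserves_qm: "preserves fam_qm Dx" "preserves fam_qm Dz"
  unfolding preserves_def
  by (intro ballI, rename_tac c, case_tac c; simp add: D_base fam_defs subalg.intros)+

text \<open>On \<open>Cq\<close> and \<open>Cm\<close>, the values of \<open>Dy\<close> and
  \<open>Dt\<close> are powers of \<open>Dx\<close> and \<open>Dz\<close> applied to the values at
  upper indices 0. Hence \<open>Dx\<close> merely raises the outer power, and \<open>Dz\<close>
  raises the inner one after passing the powers of \<open>Dx\<close>.\<close>

lemma commute_qm:
  "commute_on fam_qm Dx Dy" "commute_on fam_qm Dx Dz" "commute_on fam_qm Dx Dt"
  "commute_on fam_qm Dy Dz"
proof -
  show xz: "commute_on fam_qm Dx Dz"
    unfolding commute_on_def
    by (intro ballI, rename_tac c, case_tac c; simp add: D_base D_rules fam_qm_def)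
  have pow: "Dz ((Dx ^^ i) ((Dz ^^ j) a)) = (Dx ^^ i) (Dz ((Dz ^^ j) a))" if "a \<in> subalg fam_qm" for i j a
    by (rule commute_on_funpow[OF vector_field_D(3) vector_field_D(1) commute_on_sym[OF xz]])
      (intro preserves_funpow vector_field_D preserves_qm that)+
  note Y = of_qm_subalg[unfolded y_of_q_def t_of_q_def y_of_m_def t_of_m_def]
  \<comment> \<open>The other members of \<open>fam_qm\<close> belong to \<open>fam_u\<close>, where
    commutation is known.\<close>
  have split: "commute_on fam_qm D E"
    if "commute_on fam_u D E"
      "\<And>\<alpha> i j. D (E (coordinate (Cq \<alpha> i j))) = E (D (coordinate (Cq \<alpha> i j)))"
      "\<And>\<alpha> i j. D (E (coordinate (Cm \<alpha> i j))) = E (D (coordinate (Cm \<alpha> i j)))" for D E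
    unfolding commute_on_def
  proof
    fix c assume c: "c \<in> fam_qm" then show "D (E (coordinate c)) = E (D (coordinate c))"
      using that by (cases c) (auto simp: commute_on_def fam_defs)
  qed
  show "commute_on fam_qm Dx Dy"
    by (rule split[OF commute_u(1)]) (simp_all add: D_base D_q D_m)
  show "commute_on fam_qm Dx Dt"
    by (rule split[OF commute_u(3)]) (simp_all add: D_base D_q D_m)
  show "commute_on fam_qm Dy Dz"
    by (rule split[OF commute_u(4)])
      (simp_all only: D_base D_q D_m pow[OF Y(1)] pow[OF Y(3)] Suc_eq_plus1[symmetric] funpow.simps o_apply)
qed

text \<open>On the \<open>Cr\<close> the index-raising operators are \<open>Dy\<close> and
  \<open>Dt\<close>; closure under \<open>Dy\<close> requires the \<open>Uy\<close>, which
  \<open>fam_qm\<close> excludes.\<close>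

definition fam_ur :: "coord set" where
  "fam_ur = {c. case c of Cq _ _ _ \<Rightarrow> False | Cm _ _ _ \<Rightarrow> False | _ \<Rightarrow> True}"

lemma u_subalg_ur: "a \<in> subalg fam_u \<Longrightarrow> a \<in> subalg fam_ur"
  by (erule subalg_mono) (auto simp: fam_u_def fam_ur_def split: coord.splits)

lemma fam_ur_cases:
  assumes "c \<in> fam_ur" obtains "c \<in> fam_u" | b i j where "c = Cr b i j"
  using assms by (cases c) (auto simp: fam_u_def fam_ur_def)

lemma rr_ur: "rr b \<in> subalg fam_ur"
  by (cases b) (auto simp: rr_def fam_ur_def intro!: subalg.intros)

lemma D_rr_Suc:
  "Dx (rr (Suc b)) = u_x * Dx (rr b) - Dy (rr b)"
  "Dz (rr (Suc b)) = u_z * Dx (rr b) - Dt (rr b)"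
  by (simp_all add: rr_def[of "Suc b"] D_r)

lemma D_rr_0: "Dx (rr 0) = - u_x" "Dz (rr 0) = - u_z"
  by (simp_all add: D_rr)

lemma preserves_ur:
  "preserves fam_ur Dx" "preserves fam_ur Dy" "preserves fam_ur Dz" "preserves fam_ur Dt"
proof -
  have split: "preserves fam_ur D"
    if "preserves fam_u D" "\<And>b i j. D (coordinate (Cr b i j)) \<in> subalg fam_ur" for D
    unfolding preserves_def
    using that by (auto elim!: fam_ur_cases intro: u_subalg_ur simp: preserves_def)
  show y: "preserves fam_ur Dy"
    by (rule split[OF preserves_u(2)]) (simp add: D_base fam_ur_def subalg.intros)
  show t: "preserves fam_ur Dt"
    by (rule split[OF preserves_u(4)]) (simp add: D_base fam_ur_def subalg.intros)
  have u: "u_x \<in> subalg fam_ur" "u_z \<in> subalg fam_ur"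
    by (simp_all add: fam_ur_def subalg.intros)
  have yt: "Dy (rr b) \<in> subalg fam_ur" "Dt (rr b) \<in> subalg fam_ur" for b
    by (rule preserves_subalg[OF vector_field_D(2) y rr_ur] preserves_subalg[OF vector_field_D(4) t rr_ur])+
  \<comment> \<open>The recursion \<open>D_rr_Suc\<close> leads back to \<open>Dx\<close> of the
    preceding member and to \<open>Dy\<close>, which is already known to preserve the
    family.\<close>
  have x: "Dx (rr b) \<in> subalg fam_ur" for b
    by (induction b) (simp_all add: D_rr_0 D_rr_Suc u yt subalg.intros subalg_diff del: One_nat_def)
  show "preserves fam_ur Dx"
    by (rule split[OF preserves_u(1)], unfold D_r)
      (intro preserves_funpow vector_field_D y t subalg_diff subalg.intros x yt u)
  show "preserves fam_ur Dz"
    by (rule split[OF preserves_u(3)], unfold D_r)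
      (intro preserves_funpow vector_field_D y t subalg_diff subalg.intros x yt u)
qed

lemma D_rr_ur:
  "Dx (rr b) \<in> subalg fam_ur" "Dy (rr b) \<in> subalg fam_ur"
  "Dz (rr b) \<in> subalg fam_ur" "Dt (rr b) \<in> subalg fam_ur"
  using preserves_subalg[OF _ _ rr_ur] vector_field_D preserves_ur by blast+

lemma commute_ur_split:
  assumes "commute_on fam_u D E"
    "\<And>b i j. D (E (coordinate (Cr b i j))) = E (D (coordinate (Cr b i j)))"
  shows "commute_on fam_ur D E"
  using assms unfolding commute_on_def by (auto elim!: fam_ur_cases)

text \<open>The argument of \<open>commute_qm\<close> with \<open>Dy\<close> and \<open>Dt\<close>
  as the raising operators, in place of \<open>Dx\<close> and \<open>Dz\<close>.\<close>

lemma commute_ur: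
  "commute_on fam_ur Dx Dy" "commute_on fam_ur Dx Dt" "commute_on fam_ur Dy Dz"
  "commute_on fam_ur Dy Dt" "commute_on fam_ur Dz Dt"
proof -
  show yt: "commute_on fam_ur Dy Dt"
    by (rule commute_ur_split[OF commute_u(5)]) (simp add: D_base)
  have pow: "Dt ((Dy ^^ i) ((Dt ^^ j) a)) = (Dy ^^ i) (Dt ((Dt ^^ j) a))"
    if "a \<in> subalg fam_ur" for i j a
    by (rule commute_on_funpow[OF vector_field_D(4) vector_field_D(2) commute_on_sym[OF yt]])
      (intro preserves_funpow vector_field_D preserves_ur that)+
  have mem: "u_x * Dx (rr b) - Dy (rr b) \<in> subalg fam_ur" "u_z * Dx (rr b) - Dt (rr b) \<in> subalg fam_ur" for b
    by (intro subalg_diff subalg.intros D_rr_ur; simp add: fam_ur_def)+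
  show "commute_on fam_ur Dx Dy"
    by (rule commute_ur_split[OF commute_u(1)]) (simp add: D_base D_r)
  show "commute_on fam_ur Dx Dt"
    by (rule commute_ur_split[OF commute_u(3)]) (simp add: D_base D_r pow[OF mem(1)] Suc_eq_plus1[symmetric]
        del: One_nat_def Suc_eq_plus1)
  show "commute_on fam_ur Dy Dz"
    by (rule commute_ur_split[OF commute_u(4)]) (simp add: D_base D_r)
  show "commute_on fam_ur Dz Dt"
    by (rule commute_ur_split[OF commute_u(6)]) (simp add: D_base D_r pow[OF mem(2)] Suc_eq_plus1[symmetric]
        del: One_nat_def Suc_eq_plus1)
qed

lemma u_derivatives:
  "Dx u_x = u_xx" "Dz u_x = u_xz" "Dt u_x = u_tx" "Dx u_z = u_xz" "Dy u_z = GG"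
  using D_u(1)[of 0 0 0] by (simp_all add: D_base numeral_2_eq_2)

text \<open>
  The integrability condition of the system for \<open>r\<^sub>\<beta>\<^sub>+\<^sub>1\<close>; for \<open>r\<^sub>0 = - u\<close> it is the equation \<open>\<E>\<close>.
\<close>

lemma rr_equation: "Dy (Dz (rr b)) = Dt (Dx (rr b)) - u_z * Dx (Dx (rr b)) + u_x * Dx (Dz (rr b))"
proof (cases b)
  case 0
  then show ?thesis by (simp add: D_rr_0 D_rules u_derivatives GG_def algebra_simps del: One_nat_def)
next
  case (Suc \<beta>)
  note comm = commute_on_subalg[OF vector_field_D(1) vector_field_D(2) commute_ur(1) rr_ur]
    commute_on_subalg[OF vector_field_D(1) vector_field_D(4) commute_ur(2) rr_ur]
    commute_on_subalg[OF vector_field_D(2) vector_field_D(4) commute_ur(4) rr_ur]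
  \<comment> \<open>After the recursion is inserted, only terms with the undifferentiated factor
    \<open>Dx (rr \<beta>)\<close> survive the cancellation, and on both sides their coefficient is
    \<open>GG\<close>.\<close>
  show ?thesis
    by (simp add: Suc D_rr_Suc D_rules u_derivatives comm GG_def algebra_simps del: One_nat_def)
qed

text \<open>Once the induction hypothesis exchanges \<open>Dx\<close> and \<open>Dz\<close> on
  \<open>rr b\<close>, compatibility of the two recursions for the next member is
  \<open>rr_equation\<close> for \<open>rr b\<close>.\<close>

lemma rr_commute_xz: "Dx (Dz (rr b)) = Dz (Dx (rr b))"
proof (induction b)
  case 0
  then show ?case by (simp add: D_rr_0 D_rules u_derivatives del: One_nat_def)
next
  case (Suc b)
  note comm = commute_on_subalg[OF vector_field_D(1) vector_field_D(4) commute_ur(2) rr_ur]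
    commute_on_subalg[OF vector_field_D(2) vector_field_D(3) commute_ur(3) rr_ur]
  have "Dz (Dx (rr (Suc b))) = u_xz * Dx (rr b) + u_x * Dx (Dz (rr b)) - Dy (Dz (rr b))"
    by (simp add: D_rr_Suc D_rules u_derivatives Suc comm algebra_simps del: One_nat_def)
  also have "\<dots> = Dx (Dz (rr (Suc b)))"
    by (simp add: rr_equation D_rr_Suc D_rules u_derivatives comm algebra_simps del: One_nat_def)
  finally show ?case ..
qed

text \<open>Both operators pass the powers of \<open>Dy\<close> and \<open>Dt\<close>, which reduces
  the claim to upper indices 0.\<close>

lemma commute_ur_xz: "commute_on fam_ur Dx Dz"
proof (rule commute_ur_split[OF commute_u(2)])
  fix b i j
  note mem' = preserves_funpow vector_field_D preserves_ur D_rr_ur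
  have "Dx ((Dy ^^ i) ((Dt ^^ j) (Dz (rr (Suc b))))) = (Dy ^^ i) ((Dt ^^ j) (Dx (Dz (rr (Suc b)))))"
    by (simp add: commute_on_funpow[OF vector_field_D(1) vector_field_D(2) commute_ur(1)]
        commute_on_funpow[OF vector_field_D(1) vector_field_D(4) commute_ur(2)] mem')
  moreover have "Dz ((Dy ^^ i) ((Dt ^^ j) (Dx (rr (Suc b))))) = (Dy ^^ i) ((Dt ^^ j) (Dz (Dx (rr (Suc b)))))"
    by (simp add: commute_on_funpow[OF vector_field_D(3) vector_field_D(2) commute_on_sym[OF commute_ur(3)]]
        commute_on_funpow[OF vector_field_D(3) vector_field_D(4) commute_ur(5)] mem')
  ultimately show "Dx (Dz (coordinate (Cr b i j))) = Dz (Dx (coordinate (Cr b i j)))"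
    by (simp add: D_r D_rr_Suc[symmetric] rr_commute_xz del: One_nat_def)
qed

lemma fam_union: "fam_qm \<union> fam_ur = UNIV"
  by (auto simp: fam_qm_def fam_ur_def split: coord.splits)

text \<open>The two families exhaust the coordinates, so commutation extends to the whole algebra by
  \<open>vf_commute\<close>.\<close>

lemma D_commute: "Dx (Dy a) = Dy (Dx a)" "Dx (Dz a) = Dz (Dx a)" "Dx (Dt a) = Dt (Dx a)"
  "Dy (Dz a) = Dz (Dy a)"
proof -
  have "commute_on UNIV D E" if "commute_on fam_qm D E" "commute_on fam_ur D E" for D E
    using that unfolding commute_on_def by (metis UnE fam_union)
  then show "Dx (Dy a) = Dy (Dx a)" "Dx (Dz a) = Dz (Dx a)" "Dx (Dt a) = Dt (Dx a)"
    "Dy (Dz a) = Dz (Dy a)"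
    by (auto intro!: commute_on_UNIV vector_field_D commute_qm commute_ur commute_ur_xz)
qed

section \<open>Inverted coordinates and the entries of \<open>Rq P\<close> and
  \<open>Rm P\<close>\<close>

lemma inverse_tt: "1 / tt = inv_coordinate Ct" "zz / tt = zz * inv_coordinate Ct"
  by (simp_all add: divide_alg_def inverse_coordinate)

lemma coordinate_inv_cancel:
  "coordinate c * (inv_coordinate c * a) = a" "inv_coordinate c * (coordinate c * a) = a"
  "coordinate c * (b * (inv_coordinate c * a)) = b * a"
proof -
  show *: "coordinate c * (inv_coordinate c * a) = a" for a
    by (simp add: mult.assoc[symmetric] coordinate_inv)
  show "inv_coordinate c * (coordinate c * a) = a" "coordinate c * (b * (inv_coordinate c * a)) = b * a"
    using *[of a] *[of "b * a"] by (simp_all add: ac_simps)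
qed

lemma coordinate_cancel: "coordinate c * a = 0 \<longleftrightarrow> a = 0"
  using coordinate_inv_cancel(2)[of c a] by auto

lemma prev_simps: "prev F 0 = 0" "prev F (Suc \<alpha>) = F \<alpha>"
  by (simp_all add: prev_def)

text \<open>The last formula includes \<open>\<beta> = 0\<close>: it is the negated formula for the
  first entry, because \<open>Dx (rr 0) = - u_x\<close>.\<close>

lemma Rq_select:
  "Rq P 0 = u_x * P 0 + pr P 1"
  "pq (Rq P) \<alpha> = Dx (qq \<alpha>) * P 0 + prev (pq P) \<alpha>"
  "pm (Rq P) \<alpha> = Dx (mm \<alpha>) * P 0 - 1 / tt * prev (pm P) \<alpha> - zz / tt * pm P \<alpha>"
  "pr (Rq P) \<beta> = Dx (rr \<beta>) * P 0 - pr P (\<beta> + 1)"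
proof -
  show 0: "Rq P 0 = u_x * P 0 + pr P 1" by (simp add: Rq_def seq_of_select)
  show "pr (Rq P) \<beta> = Dx (rr \<beta>) * P 0 - pr P (\<beta> + 1)"
  proof (cases "\<beta> = 0")
    case True then show ?thesis by (simp add: pr_def 0 D_rr_0)
  next
    case False then show ?thesis by (simp add: Rq_def seq_of_select)
  qed
qed (simp_all add: Rq_def seq_of_select)

lemma combination_select:
  "pq (\<lambda>n. a * P n + b * Q n) \<alpha> = a * pq P \<alpha> + b * pq Q \<alpha>"
  "pm (\<lambda>n. a * P n + b * Q n) \<alpha> = a * pm P \<alpha> + b * pm Q \<alpha>"
  "pr (\<lambda>n. a * P n + b * Q n) \<beta> = a * pr P \<beta> + b * pr Q \<beta>"
  by (simp_all add: pq_def pm_def pr_def)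

text \<open>On the m-entries the factor t clears the denominators and the terms with z cancel, so
  \<open>Rm\<close> shifts these entries just as \<open>Rq\<close> shifts the q-entries.\<close>

lemma Rm_select:
  "Rm P 0 = tt * (u_x * P 0 + pr P 1) + zz * P 0"
  "pq (Rm P) \<alpha> = tt * (Dx (qq \<alpha>) * P 0 + prev (pq P) \<alpha>) + zz * pq P \<alpha>"
  "pm (Rm P) \<alpha> = tt * Dx (mm \<alpha>) * P 0 - prev (pm P) \<alpha>"
  "pr (Rm P) \<beta> = tt * (Dx (rr \<beta>) * P 0 - pr P (\<beta> + 1)) + zz * pr P \<beta>"
  unfolding Rm_def
  by (simp_all add: combination_select Rq_select inverse_tt coordinate_inv_cancel algebra_simps
      del: One_nat_def)

section \<open>The defining equations of the symmetries\<close>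

text \<open>
  The equations (NS2), (NS4), (NS7), (NS9) and (NS3), (NS5), (NS6), (NS8) have the same shape, for
  \<open>(E, F, w) = (D\<^sub>t, D\<^sub>z, u\<^sub>z)\<close> and \<open>(D\<^sub>y, D\<^sub>x, u\<^sub>x)\<close>; with \<open>p\<^sub>0\<^sup>r = - p\<^sub>0\<close>, (NS7) and (NS6) are the
  members \<open>\<beta> = 1\<close> of (NS9) and (NS8).
\<close>

locale lax_direction =
  fixes E F :: "alg \<Rightarrow> alg" and w e :: alg
  assumes vector_fields: "vector_field E" "vector_field F"
    and E_zz: "E zz = 0" and F_zz: "F zz = e" and E_tt: "E tt = e" and F_tt: "F tt = 0"
    and Dx_w: "Dx w = F u_x"
    and E_qq_x: "E (Dx (qq \<alpha>)) = Dx w * Dx (qq \<alpha>) + w * Dx (Dx (qq \<alpha>)) + F (prev (\<lambda>\<gamma>. Dx (qq \<gamma>)) \<alpha>)"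
    and E_mm_x: "E (Dx (mm \<alpha>)) = Dx w * Dx (mm \<alpha>) + w * Dx (Dx (mm \<alpha>))
      - zz / tt * F (Dx (mm \<alpha>)) - 1 / tt * F (prev (\<lambda>\<gamma>. Dx (mm \<gamma>)) \<alpha>)"
    and F_rr_x: "F (Dx (rr (Suc \<beta>))) = Dx w * Dx (rr \<beta>) + w * Dx (Dx (rr \<beta>)) - E (Dx (rr \<beta>))"
begin

definition residual_q :: "(nat \<Rightarrow> alg) \<Rightarrow> nat \<Rightarrow> alg" where
  "residual_q P \<alpha> = E (pq P \<alpha>) - w * Dx (pq P \<alpha>) - Dx (qq \<alpha>) * F (P 0) - F (prev (pq P) \<alpha>)"

definition residual_m :: "(nat \<Rightarrow> alg) \<Rightarrow> nat \<Rightarrow> alg" where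
  "residual_m P \<alpha> = E (pm P \<alpha>) - w * Dx (pm P \<alpha>) - Dx (mm \<alpha>) * F (P 0)
     + zz / tt * F (pm P \<alpha>) + 1 / tt * F (prev (pm P) \<alpha>)"

text \<open>The index is shifted: \<open>residual_r P \<beta>\<close> belongs to the equation for
  the entry \<open>Suc \<beta>\<close>.\<close>

definition residual_r :: "(nat \<Rightarrow> alg) \<Rightarrow> nat \<Rightarrow> alg" where
  "residual_r P \<beta> = F (pr P (Suc \<beta>)) - w * Dx (pr P \<beta>) - Dx (rr \<beta>) * F (P 0) + E (pr P \<beta>)"

definition symmetric_along :: "(nat \<Rightarrow> alg) \<Rightarrow> bool" where
  "symmetric_along P \<longleftrightarrow> (\<forall>\<alpha>. residual_q P \<alpha> = 0 \<and> residual_m P \<alpha> = 0 \<and> residual_r P \<alpha> = 0)"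

lemmas EF_rules = vector_field_rules[OF vector_fields(1)] vector_field_rules[OF vector_fields(2)]
  vector_field_rules[OF vector_field_D(1)] E_zz F_zz E_tt F_tt
lemmas residual_simps = residual_q_def residual_m_def residual_r_def Rq_select Rm_select
  EF_rules E_qq_x E_mm_x F_rr_x prev_simps inverse_tt D_base

definition defect_q :: "(nat \<Rightarrow> alg) \<Rightarrow> alg" where
  "defect_q P = E (P 0) - w * Dx (P 0) + Dx w * P 0 - F (Rq P 0)"

text \<open>This is \<open>tt * defect_q P\<close> written out, since \<open>F tt = 0\<close> and
  \<open>F zz = e\<close>.\<close>

definition defect_m :: "(nat \<Rightarrow> alg) \<Rightarrow> alg" where
  "defect_m P = e * P 0 + tt * (E (P 0) - w * Dx (P 0) + Dx w * P 0) + zz * F (P 0) - F (Rm P 0)"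

text \<open>By the Leibniz rule, the terms with \<open>P 0\<close> collect into the defect and the
  rest into residuals of \<open>P\<close>. The terms from differentiating z/t and 1/t cancel because
  \<open>F zz\<close> and \<open>E tt\<close> coincide while \<open>E zz\<close> and
  \<open>F tt\<close> vanish.\<close>

lemma residual_Rq:
  "residual_q (Rq P) 0 = Dx (qq 0) * defect_q P"
  "residual_q (Rq P) (Suc \<alpha>) = Dx (qq (Suc \<alpha>)) * defect_q P + residual_q P \<alpha>"
  "residual_m (Rq P) \<alpha> = Dx (mm \<alpha>) * defect_q P - zz / tt * residual_m P \<alpha>
     - 1 / tt * prev (residual_m P) \<alpha>"
  "residual_r (Rq P) \<beta> = Dx (rr \<beta>) * defect_q P - residual_r P (Suc \<beta>)"
  "residual_r P 0 = - defect_q P"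
proof -
  show "residual_m (Rq P) \<alpha> = Dx (mm \<alpha>) * defect_q P - zz / tt * residual_m P \<alpha>
     - 1 / tt * prev (residual_m P) \<alpha>"
    by (cases \<alpha>) (simp_all add: residual_simps defect_q_def algebra_simps)
  show "residual_r P 0 = - defect_q P"
    by (simp add: residual_simps defect_q_def algebra_simps Dx_w D_rr_0 pr_def del: One_nat_def)
qed (simp_all add: residual_simps defect_q_def algebra_simps)

lemma residual_Rm:
  "residual_m (Rm P) 0 = Dx (mm 0) * defect_m P"
  "residual_m (Rm P) (Suc \<alpha>) = Dx (mm (Suc \<alpha>)) * defect_m P - residual_m P \<alpha>"
  "residual_q (Rm P) \<alpha> = Dx (qq \<alpha>) * defect_m P + tt * prev (residual_q P) \<alpha> + zz * residual_q P \<alpha>"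
  "residual_r (Rm P) \<beta> = Dx (rr \<beta>) * defect_m P - tt * residual_r P (Suc \<beta>) + zz * residual_r P \<beta>"
  "tt * residual_r P 0 = - defect_m P"
proof -
  show "residual_q (Rm P) \<alpha> = Dx (qq \<alpha>) * defect_m P + tt * prev (residual_q P) \<alpha> + zz * residual_q P \<alpha>"
    by (cases \<alpha>) (simp_all add: residual_simps defect_m_def algebra_simps)
  show "tt * residual_r P 0 = - defect_m P"
    by (simp add: residual_simps defect_m_def algebra_simps Dx_w D_rr_0 pr_def del: One_nat_def)
qed (simp_all add: residual_simps defect_m_def algebra_simps coordinate_inv_cancel)

lemma symmetric_along_Rq:
  assumes "symmetric_along (Rq P)"
  shows "symmetric_along P" "defect_q P = 0"
proof -
  have "residual_q (Rq P) 0 = 0" using assms by (simp add: symmetric_along_def)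
  then show defect: "defect_q P = 0"
    by (simp add: residual_Rq qq_def D_base coordinate_cancel)
  have q: "residual_q P \<alpha> = 0" for \<alpha>
    using assms residual_Rq(2)[of P \<alpha>] by (simp add: defect symmetric_along_def)
  have m: "residual_m P \<alpha> = 0" for \<alpha>
  proof (induction \<alpha>)
    case 0
    show ?case using assms residual_Rq(3)[of P 0]
      by (simp add: defect symmetric_along_def prev_simps inverse_tt mult.assoc coordinate_cancel)
        (metis coordinate_inv_cancel(1) mult_zero_right)
  next
    case (Suc \<alpha>)
    show ?case using assms residual_Rq(3)[of P "Suc \<alpha>"]
      by (simp add: defect symmetric_along_def prev_simps inverse_tt mult.assoc coordinate_cancel Suc)
        (metis coordinate_inv_cancel(1) mult_zero_right)
  qed
  \<comment> \<open>Index 0 is minus the defect; a positive index is read off from the preceding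
    residual of \<open>Rq P\<close>.\<close>
  have r: "residual_r P \<beta> = 0" for \<beta>
    using assms residual_Rq(4)[of P "\<beta> - 1"] residual_Rq(5)[of P]
    by (cases \<beta>) (simp_all add: defect symmetric_along_def)
  show "symmetric_along P" using q m r by (simp add: symmetric_along_def)
qed

text \<open>Now the m-residuals follow by the shift, while the q- and r-residuals need induction,
  with the units z and t as leading factors.\<close>

lemma symmetric_along_Rm:
  assumes "symmetric_along (Rm P)"
  shows "symmetric_along P" "defect_m P = 0"
proof -
  have "residual_m (Rm P) 0 = 0" using assms by (simp add: symmetric_along_def)
  then show defect: "defect_m P = 0"
    by (simp add: residual_Rm mm_def D_base coordinate_cancel)
  have m: "residual_m P \<alpha> = 0" for \<alpha>
    using assms residual_Rm(2)[of P \<alpha>] by (simp add: defect symmetric_along_def)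
  have q: "residual_q P \<alpha> = 0" for \<alpha>
  proof (induction \<alpha>)
    case 0
    show ?case using assms residual_Rm(3)[of P 0]
      by (simp add: defect symmetric_along_def prev_simps coordinate_cancel)
  next
    case (Suc \<alpha>)
    show ?case using assms residual_Rm(3)[of P "Suc \<alpha>"]
      by (simp add: defect symmetric_along_def prev_simps coordinate_cancel Suc)
  qed
  have r: "residual_r P \<beta> = 0" for \<beta>
  proof (induction \<beta>)
    case 0
    show ?case using residual_Rm(5)[of P] by (simp add: defect coordinate_cancel)
  next
    case (Suc \<beta>)
    show ?case using assms residual_Rm(4)[of P \<beta>]
      by (simp add: defect symmetric_along_def Suc coordinate_cancel)
  qed
  show "symmetric_along P" using q m r by (simp add: symmetric_along_def)
qed

end

section \<open>The two directions and the return to symmetries\<close>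

lemma qq_mm_D:
  "Dy (qq \<alpha>) = u_x * Dx (qq \<alpha>) + prev (\<lambda>\<gamma>. Dx (qq \<gamma>)) \<alpha>"
  "Dt (qq \<alpha>) = u_z * Dx (qq \<alpha>) + prev (\<lambda>\<gamma>. Dz (qq \<gamma>)) \<alpha>"
  "Dy (mm \<alpha>) = u_x * Dx (mm \<alpha>) - zz / tt * Dx (mm \<alpha>) - 1 / tt * prev (\<lambda>\<gamma>. Dx (mm \<gamma>)) \<alpha>"
  "Dt (mm \<alpha>) = u_z * Dx (mm \<alpha>) - zz / tt * Dz (mm \<alpha>) - 1 / tt * prev (\<lambda>\<gamma>. Dz (mm \<gamma>)) \<alpha>"
  by (simp_all add: qq_def mm_def D_base D_q D_m)

lemma D_prev:
  "Dx (prev G \<alpha>) = prev (\<lambda>\<gamma>. Dx (G \<gamma>)) \<alpha>" "Dz (prev G \<alpha>) = prev (\<lambda>\<gamma>. Dz (G \<gamma>)) \<alpha>"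
  by (cases \<alpha>; simp add: prev_simps D_rules)+

interpretation zt: lax_direction Dt Dz u_z 1
proof unfold_locales
  note comm = D_commute(3)[symmetric] D_commute(2)[symmetric]
  show "Dt (Dx (qq \<alpha>)) = Dx u_z * Dx (qq \<alpha>) + u_z * Dx (Dx (qq \<alpha>)) + Dz (prev (\<lambda>\<gamma>. Dx (qq \<gamma>)) \<alpha>)"
    "Dt (Dx (mm \<alpha>)) = Dx u_z * Dx (mm \<alpha>) + u_z * Dx (Dx (mm \<alpha>))
      - zz / tt * Dz (Dx (mm \<alpha>)) - 1 / tt * Dz (prev (\<lambda>\<gamma>. Dx (mm \<gamma>)) \<alpha>)" for \<alpha>
    by (simp_all add: comm D_prev qq_mm_D D_rules D_base inverse_tt algebra_simps)
  \<comment> \<open>\<open>Dz\<close> is first moved next to \<open>rr (Suc \<beta>)\<close>, so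
    that its recursion is the one applied.\<close>
  show "Dz (Dx (rr (Suc \<beta>))) = Dx u_z * Dx (rr \<beta>) + u_z * Dx (Dx (rr \<beta>)) - Dt (Dx (rr \<beta>))" for \<beta>
    unfolding D_commute(2)[symmetric] unfolding D_rr_Suc by (simp add: comm D_rules algebra_simps)
qed (simp_all add: vector_field_D D_base)

interpretation xy: lax_direction Dy Dx u_x 0
proof unfold_locales
  note comm = D_commute(1)[symmetric]
  show "Dy (Dx (qq \<alpha>)) = Dx u_x * Dx (qq \<alpha>) + u_x * Dx (Dx (qq \<alpha>)) + Dx (prev (\<lambda>\<gamma>. Dx (qq \<gamma>)) \<alpha>)"
    "Dy (Dx (mm \<alpha>)) = Dx u_x * Dx (mm \<alpha>) + u_x * Dx (Dx (mm \<alpha>))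
      - zz / tt * Dx (Dx (mm \<alpha>)) - 1 / tt * Dx (prev (\<lambda>\<gamma>. Dx (mm \<gamma>)) \<alpha>)" for \<alpha>
    by (simp_all add: comm D_prev qq_mm_D D_rules D_base inverse_tt algebra_simps)
  show "Dx (Dx (rr (Suc \<beta>))) = Dx u_x * Dx (rr \<beta>) + u_x * Dx (Dx (rr \<beta>)) - Dy (Dx (rr \<beta>))" for \<beta>
    by (simp add: comm D_rr_Suc D_rules algebra_simps)
qed (simp_all add: vector_field_D D_base)

definition linearized_equation :: "alg \<Rightarrow> alg" where
  "linearized_equation a = Dy (Dz a) - Dt (Dx a) + u_z * Dx (Dx a) - u_x * Dx (Dz a)
     + u_xx * Dz a - u_xz * Dx a"

lemma tau_sym_iff:
  "P \<in> tau_sym \<longleftrightarrow>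
     linearized_equation (P 0) = 0 \<and> zt.symmetric_along P \<and> xy.symmetric_along P"
proof -
  \<comment> \<open>Index 0 gives (NS7) or (NS6), and \<open>\<beta> - 1\<close> with
    \<open>\<beta> \<ge> 2\<close> gives (NS9) or (NS8).\<close>
  have split: "(\<forall>\<beta>. S \<beta>) \<longleftrightarrow> S 0 \<and> (\<forall>\<beta>\<ge>2. S (\<beta> - 1))" for S :: "nat \<Rightarrow> bool"
  proof (intro iffI allI)
    fix \<beta> assume *: "S 0 \<and> (\<forall>\<beta>\<ge>2. S (\<beta> - 1))"
    then show "S \<beta>" using *[THEN conjunct2, rule_format, of "Suc \<beta>"] by (cases \<beta>) auto
  qed auto
  have "(\<forall>\<beta>. zt.residual_r P \<beta> = 0) \<longleftrightarrow> Dz (pr P 1) - Dt (P 0) + u_x * Dz (P 0) + u_z * Dx (P 0) = 0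
      \<and> (\<forall>\<beta>\<ge>2. Dz (pr P \<beta>) - u_z * Dx (pr P (\<beta> - 1)) - Dx (rr (\<beta> - 1)) * Dz (P 0)
        + Dt (pr P (\<beta> - 1)) = 0)"
    unfolding split[of "\<lambda>\<beta>. zt.residual_r P \<beta> = 0"]
    by (intro arg_cong2[where f = conj] all_cong)
      (simp_all add: zt.residual_r_def pr_def[of P 0] D_rr_0 D_rules algebra_simps)
  moreover have "(\<forall>\<beta>. xy.residual_r P \<beta> = 0) \<longleftrightarrow> Dx (pr P 1) - Dy (P 0) + 2 * u_x * Dx (P 0) = 0
      \<and> (\<forall>\<beta>\<ge>2. Dx (pr P \<beta>) - u_x * Dx (pr P (\<beta> - 1)) - Dx (rr (\<beta> - 1)) * Dx (P 0)
        + Dy (pr P (\<beta> - 1)) = 0)"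
    unfolding split[of "\<lambda>\<beta>. xy.residual_r P \<beta> = 0"]
    by (intro arg_cong2[where f = conj] all_cong)
      (simp_all add: xy.residual_r_def pr_def[of P 0] D_rr_0 D_rules algebra_simps
        flip: One_nat_def)
  ultimately show ?thesis
    unfolding tau_sym_def zt.symmetric_along_def xy.symmetric_along_def all_conj_distrib
      zt.residual_q_def zt.residual_m_def xy.residual_q_def xy.residual_m_def linearized_equation_def
    by simp blast
qed

lemma Dx_u_xz: "Dx u_xz = Dz u_xx"
  by (simp add: D_base numeral_2_eq_2)

lemma tau_sym_Rq: assumes "Rq P \<in> tau_sym" shows "P \<in> tau_sym"
proof -
  have zt: "zt.symmetric_along (Rq P)" and xy: "xy.symmetric_along (Rq P)"
    using assms by (auto simp: tau_sym_iff)
  \<comment> \<open>The second derivatives of \<open>Rq P 0\<close> cancel by commutation, and the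
    terms with undifferentiated \<open>P 0\<close> cancel by \<open>Dx_u_xz\<close>.\<close>
  have "Dx (zt.defect_q P) - Dz (xy.defect_q P) = - linearized_equation (P 0)"
    by (simp add: zt.defect_q_def xy.defect_q_def linearized_equation_def D_rules u_derivatives
        Dx_u_xz
        D_commute algebra_simps del: One_nat_def)
  then show ?thesis
    using zt.symmetric_along_Rq[OF zt] xy.symmetric_along_Rq[OF xy]
    by (simp add: tau_sym_iff D_rules)
qed

lemma tau_sym_Rm: assumes "Rm P \<in> tau_sym" shows "P \<in> tau_sym"
proof -
  have zt: "zt.symmetric_along (Rm P)" and xy: "xy.symmetric_along (Rm P)"
    using assms by (auto simp: tau_sym_iff)
  \<comment> \<open>The same identity multiplied by t, which \<open>Dx\<close> and \<open>Dz\<close>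
    treat as a constant.\<close>
  have "Dx (zt.defect_m P) - Dz (xy.defect_m P) = - (tt * linearized_equation (P 0))"
    by (simp add: zt.defect_m_def xy.defect_m_def linearized_equation_def D_rules u_derivatives
        Dx_u_xz
        Dx_base(3,4) Dz_base(3,4) D_commute algebra_simps del: One_nat_def)
  then show ?thesis
    using zt.symmetric_along_Rm[OF zt] xy.symmetric_along_Rm[OF xy]
    by (simp add: tau_sym_iff D_rules coordinate_cancel)
qed

section \<open>The inverses\<close>

lemma seq_eq_iff:
  "P = Q \<longleftrightarrow> (\<forall>\<alpha>. pq P \<alpha> = pq Q \<alpha>) \<and> (\<forall>\<alpha>. pm P \<alpha> = pm Q \<alpha>) \<and> (\<forall>\<beta>. pr P \<beta> = pr Q \<beta>)"
proof (intro iffI ext; (elim conjE)?)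
  fix n :: nat assume *: "\<forall>\<alpha>. pq P \<alpha> = pq Q \<alpha>" "\<forall>\<alpha>. pm P \<alpha> = pm Q \<alpha>" "\<forall>\<beta>. pr P \<beta> = pr Q \<beta>"
  consider "n = 0" | k where "n = 3 * k" "k \<noteq> 0" | k where "n = 3 * k + 1" | k where "n = 3 * k + 2"
    by atomize_elim presburger
  then show "P n = Q n"
  proof cases
    case 1 then show ?thesis using *(3)[rule_format, of 0] by (simp add: pr_def)
  next
    case (2 k) then show ?thesis using *(3)[rule_format, of k] by (simp add: pr_def)
  next
    case (3 k) then show ?thesis using *(1)[rule_format, of k] by (simp add: pq_def)
  next
    case (4 k) then show ?thesis using *(2)[rule_format, of k] by (simp add: pm_def)
  qed
qed simp

lemma all_nat_split: "(\<forall>n. S n) \<longleftrightarrow> S 0 \<and> (\<forall>n. S (Suc n))" for S :: "nat \<Rightarrow> bool"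
  by (metis not0_implies_Suc)

lemma all_ge_1: "(\<forall>n\<ge>1. S n) \<longleftrightarrow> (\<forall>n. S (Suc n))" for S :: "nat \<Rightarrow> bool"
  by (metis One_nat_def Suc_le_D Suc_le_mono le0)

text \<open>Unique solvability of \<open>R P = Q\<close> in explicit form: one direction of the
  equivalence gives injectivity, the other surjectivity.\<close>

lemma bij_explicit:
  assumes R: "\<And>P Q. R P = Q \<longleftrightarrow> P 0 = p0 Q \<and> (\<forall>\<alpha>. pq P \<alpha> = q Q \<alpha>) \<and> (\<forall>\<alpha>. pm P \<alpha> = m Q \<alpha>)
    \<and> (\<forall>\<beta>\<ge>1. pr P \<beta> = r Q \<beta>)"
  shows "bij R"
proof -
  have "R P = Q \<longleftrightarrow> P = seq_of (p0 Q) (q Q) (m Q) (r Q)" for P Q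
    unfolding R seq_eq_iff[of P] all_nat_split[of "\<lambda>\<beta>. pr P \<beta> = pr _ \<beta>"] all_ge_1
    by (auto simp: seq_of_select pr_def[of _ 0])
  note iff = this
  have "R (seq_of (p0 Q) (q Q) (m Q) (r Q)) = Q" for Q by (simp only: iff)
  from this[symmetric] have "surj R" unfolding surj_def by blast
  moreover have "inj R"
  proof (rule injI)
    fix P P' assume "R P = R P'"
    then have "P = seq_of (p0 (R P')) (q (R P')) (m (R P')) (r (R P'))" by (simp only: iff[symmetric])
    moreover have "P' = \<dots>" by (simp only: iff[symmetric])
    ultimately show "P = P'" by simp
  qed
  ultimately show ?thesis by (simp add: bij_def)
qed

text \<open>The sums satisfy the recurrence, and with the member of index -1 equal to 0 the
  recurrence determines the sequence.\<close>

lemma recurrence_prev: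
  fixes a b :: alg
  shows "(\<forall>\<alpha>. x \<alpha> = a * y \<alpha> + b * prev x \<alpha>) \<longleftrightarrow> (\<forall>\<alpha>. x \<alpha> = (\<Sum>j=0..\<alpha>. b ^ (\<alpha> - j) * a * y j))"
proof -
  define S where "S \<alpha> = (\<Sum>j=0..\<alpha>. b ^ (\<alpha> - j) * a * y j)" for \<alpha>
  have "S (Suc \<alpha>) = a * y (Suc \<alpha>) + b * S \<alpha>" for \<alpha>
  proof -
    have "(\<Sum>j=0..\<alpha>. b ^ (Suc \<alpha> - j) * a * y j) = b * S \<alpha>"
      unfolding S_def sum_distrib_left by (rule sum.cong) (auto simp: Suc_diff_le mult.assoc)
    then show ?thesis by (simp add: S_def)
  qed
  then have S: "S \<alpha> = a * y \<alpha> + b * prev S \<alpha>" for \<alpha>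
    by (cases \<alpha>) (simp_all add: prev_simps S_def)
  have "x \<alpha> = S \<alpha>" if "\<forall>\<alpha>. x \<alpha> = a * y \<alpha> + b * prev x \<alpha>" for \<alpha>
  proof (induction \<alpha>)
    case 0 show ?case using that S by (metis prev_simps(1))
  next
    case (Suc \<alpha>) show ?case using that S Suc by (metis prev_simps(2))
  qed
  moreover have "\<forall>\<alpha>. x \<alpha> = a * y \<alpha> + b * prev x \<alpha>" if "\<forall>\<alpha>. x \<alpha> = S \<alpha>"
    using that S by (metis ext)
  ultimately show ?thesis unfolding S_def by blast
qed

lemma recurrence_Suc:
  fixes b :: alg
  shows "(\<forall>\<beta>. x (Suc \<beta>) = b * x \<beta> + y \<beta>)
    \<longleftrightarrow> (\<forall>\<beta>. x (Suc \<beta>) = b ^ Suc \<beta> * x 0 + (\<Sum>j=0..\<beta>. b ^ (\<beta> - j) * y j))"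
proof -
  \<comment> \<open>The empty sum makes \<open>S 0 = x 0\<close>, so the formula extends to the
    starting index.\<close>
  define S where "S \<beta> = b ^ \<beta> * x 0 + (\<Sum>j<\<beta>. b ^ (\<beta> - 1 - j) * y j)" for \<beta>
  have S: "S (Suc \<beta>) = b * S \<beta> + y \<beta>" for \<beta>
  proof -
    have "(\<Sum>j<\<beta>. b ^ (\<beta> - j) * y j) = b * (\<Sum>j<\<beta>. b ^ (\<beta> - 1 - j) * y j)"
      unfolding sum_distrib_left
    proof (rule sum.cong)
      fix j assume "j \<in> {..<\<beta>}"
      then have "\<beta> - j = Suc (\<beta> - 1 - j)" by auto
      then show "b ^ (\<beta> - j) * y j = b * (b ^ (\<beta> - 1 - j) * y j)" by (simp add: mult.assoc)
    qed simp
    then show ?thesis by (simp add: S_def algebra_simps)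
  qed
  have S0: "S 0 = x 0" by (simp add: S_def)
  have "x \<beta> = S \<beta>" if "\<forall>\<beta>. x (Suc \<beta>) = b * x \<beta> + y \<beta>" for \<beta>
    by (induction \<beta>) (simp_all add: S0 S that)
  moreover have "\<forall>\<beta>. x (Suc \<beta>) = b * x \<beta> + y \<beta>" if *: "\<forall>\<beta>. x (Suc \<beta>) = S (Suc \<beta>)"
  proof
    fix \<beta>
    have "x \<beta> = S \<beta>" using * S0 by (cases \<beta>) auto
    then show "x (Suc \<beta>) = b * x \<beta> + y \<beta>" using * S by simp
  qed
  ultimately have "(\<forall>\<beta>. x (Suc \<beta>) = b * x \<beta> + y \<beta>) \<longleftrightarrow> (\<forall>\<beta>. x (Suc \<beta>) = S (Suc \<beta>))"
    by blast
  then show ?thesis by (simp add: S_def lessThan_Suc_atMost atMost_atLeast0)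
qed

text \<open>Inverses in \<open>alg\<close> are identified by exhibiting a factor whose product is
  1.\<close>

lemma inverse_power:
  "inverse (coordinate c ^ n) = inv_coordinate c ^ n"
  "inverse ((- coordinate c) ^ n) = (- inv_coordinate c) ^ n"
  by (rule alg_inverse_unique; simp add: power_mult_distrib[symmetric] coordinate_inv)+

lemma qq_mm_x: "Dx (qq \<alpha>) = coordinate (Cq \<alpha> 1 0)" "Dx (mm \<alpha>) = coordinate (Cm \<alpha> 1 0)"
  by (simp_all add: qq_def mm_def D_base)

lemma inverse_mult_coordinate:
  "inverse (coordinate c * coordinate d) = inv_coordinate c * inv_coordinate d"
  by (rule alg_inverse_unique) (simp add: ac_simps coordinate_inv_cancel coordinate_inv)

lemma inverse_leading:
  "inverse (Dx (qq 0)) = inv_coordinate (Cq 0 1 0)"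
  "inverse (Dx (mm 0)) = inv_coordinate (Cm 0 1 0)"
  "inverse (tt * Dx (mm 0)) = inv_coordinate Ct * inv_coordinate (Cm 0 1 0)"
  unfolding qq_mm_x inverse_coordinate inverse_mult_coordinate
  by simp_all

lemma coordinate_solve: "coordinate c * a = b \<longleftrightarrow> a = inv_coordinate c * b"
  using coordinate_inv_cancel by metis

text \<open>The first q-equation gives \<open>P 0\<close>, as its coefficient is a unit. The other
  q-equations and the r-equations are shifts; the m-equations form a recurrence with factor
  -1/z.\<close>

lemma Rq_eq_iff:
  "Rq P = Q \<longleftrightarrow>
     P 0 = pq Q 0 / Dx (qq 0) \<and>
     (\<forall>\<alpha>. pq P \<alpha> = - (Dx (qq (\<alpha> + 1)) / Dx (qq 0)) * pq Q 0 + pq Q (\<alpha> + 1)) \<and>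
     (\<forall>\<alpha>. pm P \<alpha> = (\<Sum>j=0..\<alpha>. tt * pm Q j / (- zz) ^ (\<alpha> - j + 1))
        - tt * pq Q 0 / Dx (qq 0) * (\<Sum>j=0..\<alpha>. Dx (mm j) / (- zz) ^ (\<alpha> - j + 1))) \<and>
     (\<forall>\<beta>\<ge>1. pr P \<beta> = Dx (rr (\<beta> - 1)) / Dx (qq 0) * pq Q 0 - pr Q (\<beta> - 1))"
proof -
  have q: "(\<forall>\<alpha>. pq (Rq P) \<alpha> = pq Q \<alpha>) \<longleftrightarrow> P 0 = pq Q 0 / Dx (qq 0) \<and>
      (\<forall>\<alpha>. pq P \<alpha> = - Dx (qq (Suc \<alpha>)) * P 0 + pq Q (Suc \<alpha>))"
    unfolding all_nat_split[of "\<lambda>\<alpha>. pq (Rq P) \<alpha> = _ \<alpha>"]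
    by (simp add: Rq_select prev_simps divide_alg_def inverse_leading qq_mm_x(1)[of 0]
        inverse_coordinate coordinate_solve mult.commute[of "pq Q 0"] del: One_nat_def)
      (auto simp: algebra_simps)
  have "pm (Rq P) \<alpha> = pm Q \<alpha> \<longleftrightarrow> pm P \<alpha> = - inv_coordinate Cz * (tt * (pm Q \<alpha> - Dx (mm \<alpha>) * P 0))
      + - inv_coordinate Cz * prev (pm P) \<alpha>" for \<alpha>
  proof -
    have "pm (Rq P) \<alpha> = pm Q \<alpha> \<longleftrightarrow>
        coordinate Ct * (Dx (mm \<alpha>) * P 0 - pm Q \<alpha>) = prev (pm P) \<alpha> + coordinate Cz * pm P \<alpha>"
      by (simp add: Rq_select inverse_tt coordinate_solve algebra_simps coordinate_inv_cancel)
    also have "\<dots> \<longleftrightarrow> coordinate Cz * pm P \<alpha> = tt * (Dx (mm \<alpha>) * P 0 - pm Q \<alpha>) - prev (pm P) \<alpha>"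
      by (auto simp: algebra_simps)
    finally show ?thesis unfolding coordinate_solve by (simp add: algebra_simps)
  qed
  note eq = this
  \<comment> \<open>\<open>P 0\<close> stands for its known value here; the substitution is made at
    the end.\<close>
  have m: "(\<forall>\<alpha>. pm (Rq P) \<alpha> = pm Q \<alpha>) \<longleftrightarrow>
      (\<forall>\<alpha>. pm P \<alpha> = (\<Sum>j=0..\<alpha>. tt * pm Q j / (- zz) ^ (\<alpha> - j + 1))
        - tt * P 0 * (\<Sum>j=0..\<alpha>. Dx (mm j) / (- zz) ^ (\<alpha> - j + 1)))"
    unfolding eq recurrence_prev divide_alg_def inverse_power
    by (simp add: sum_distrib_left sum_subtractf[symmetric] algebra_simps)
  \<comment> \<open>The equation of index 0, that for \<open>Q 0\<close>, determines the entry of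
    index 1.\<close>
  have r: "(\<forall>\<beta>. pr (Rq P) \<beta> = pr Q \<beta>) \<longleftrightarrow> (\<forall>\<beta>\<ge>1. pr P \<beta> = Dx (rr (\<beta> - 1)) * P 0 - pr Q (\<beta> - 1))"
    unfolding all_ge_1 by (auto simp: Rq_select algebra_simps)
  have "a / Dx (qq 0) * pq Q 0 = a * P 0" "tt * pq Q 0 / Dx (qq 0) = tt * P 0"
    if "P 0 = pq Q 0 / Dx (qq 0)" for a
    by (simp_all add: that divide_alg_def ac_simps)
  then show ?thesis
    unfolding seq_eq_iff[of "Rq P"] q m r Suc_eq_plus1
    by (simp only: mult_minus_left cong: conj_cong) blast
qed

text \<open>The first m-equation gives \<open>P 0\<close> and the others are shifts. The q-equations
  form a recurrence with factor -t/z, the r-equations one with factor z/t.\<close>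

lemma Rm_eq_iff:
  "Rm P = Q \<longleftrightarrow>
     P 0 = pm Q 0 / (tt * Dx (mm 0)) \<and>
     (\<forall>\<alpha>. pq P \<alpha> = (\<Sum>j=0..\<alpha>. (- tt) ^ (\<alpha> - j) * pq Q j / zz ^ (\<alpha> - j + 1))
        - pm Q 0 / Dx (mm 0) * (\<Sum>j=0..\<alpha>. (- tt) ^ (\<alpha> - j) * Dx (qq j) / zz ^ (\<alpha> - j + 1))) \<and>
     (\<forall>\<alpha>. pm P \<alpha> = Dx (mm (\<alpha> + 1)) / Dx (mm 0) * pm Q 0 - pm Q (\<alpha> + 1)) \<and>
     (\<forall>\<beta>\<ge>1. pr P \<beta> = - (\<Sum>j=0..\<beta>-1. zz ^ (\<beta> - j - 1) * pr Q j / tt ^ (\<beta> - j))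
        + pm Q 0 / Dx (mm 0) * (- (zz ^ \<beta> / tt ^ (\<beta> + 1))
            + (\<Sum>j=1..\<beta>. zz ^ (\<beta> - j) * Dx (rr (j - 1)) / tt ^ (\<beta> - j + 1))))"
proof -
  let ?\<zeta> = "inv_coordinate Cz" and ?\<tau> = "inv_coordinate Ct"
  have m: "(\<forall>\<alpha>. pm (Rm P) \<alpha> = pm Q \<alpha>) \<longleftrightarrow> P 0 = pm Q 0 / (tt * Dx (mm 0)) \<and>
      (\<forall>\<alpha>. pm P \<alpha> = Dx (mm (Suc \<alpha>)) * (tt * P 0) - pm Q (Suc \<alpha>))"
    unfolding all_nat_split[of "\<lambda>\<alpha>. pm (Rm P) \<alpha> = _ \<alpha>"]
    by (simp add: Rm_select prev_simps divide_alg_def inverse_leading qq_mm_x(2)[of 0]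
        inverse_coordinate inverse_mult_coordinate coordinate_solve mult.assoc mult.commute[of "pm Q 0"] del: One_nat_def)
      (auto simp: algebra_simps)
  have "pq (Rm P) \<alpha> = pq Q \<alpha> \<longleftrightarrow> pq P \<alpha> = ?\<zeta> * (pq Q \<alpha> - Dx (qq \<alpha>) * (tt * P 0))
      + (- tt * ?\<zeta>) * prev (pq P) \<alpha>" for \<alpha>
  proof -
    have "pq (Rm P) \<alpha> = pq Q \<alpha> \<longleftrightarrow>
        coordinate Cz * pq P \<alpha> = pq Q \<alpha> - tt * (Dx (qq \<alpha>) * P 0 + prev (pq P) \<alpha>)"
      by (auto simp: Rm_select algebra_simps)
    then show ?thesis unfolding coordinate_solve by (simp add: algebra_simps)
  qed
  note eq = this
  have q: "(\<forall>\<alpha>. pq (Rm P) \<alpha> = pq Q \<alpha>) \<longleftrightarrow>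
      (\<forall>\<alpha>. pq P \<alpha> = (\<Sum>j=0..\<alpha>. (- tt) ^ (\<alpha> - j) * pq Q j / zz ^ (\<alpha> - j + 1))
        - tt * P 0 * (\<Sum>j=0..\<alpha>. (- tt) ^ (\<alpha> - j) * Dx (qq j) / zz ^ (\<alpha> - j + 1)))"
    unfolding eq recurrence_prev divide_alg_def inverse_power power_mult_distrib
    by (simp add: sum_distrib_left sum_subtractf[symmetric] algebra_simps)
  have "pr (Rm P) \<beta> = pr Q \<beta> \<longleftrightarrow> pr P (Suc \<beta>) = (zz * ?\<tau>) * pr P \<beta>
      + ?\<tau> * (Dx (rr \<beta>) * (tt * P 0) - pr Q \<beta>)" for \<beta>
  proof -
    have "pr (Rm P) \<beta> = pr Q \<beta> \<longleftrightarrow>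
        coordinate Ct * pr P (Suc \<beta>) = zz * pr P \<beta> + tt * (Dx (rr \<beta>) * P 0) - pr Q \<beta>"
      by (auto simp: Rm_select algebra_simps)
    then show ?thesis unfolding coordinate_solve by (simp add: algebra_simps)
  qed
  note eq = this
  have "(\<forall>\<beta>. pr (Rm P) \<beta> = pr Q \<beta>) \<longleftrightarrow>
      (\<forall>\<beta>. pr P (Suc \<beta>) = (zz * ?\<tau>) ^ Suc \<beta> * pr P 0
        + (\<Sum>j=0..\<beta>. (zz * ?\<tau>) ^ (\<beta> - j) * (?\<tau> * (Dx (rr j) * (tt * P 0) - pr Q j))))"
    unfolding eq by (rule recurrence_Suc)
  \<comment> \<open>The separate power of z over a power of t comes from the starting value
    \<open>pr P 0 = - P 0\<close>.\<close>
  also have "\<dots> \<longleftrightarrow> (\<forall>\<beta>. pr P (Suc \<beta>) = - (\<Sum>j=0..\<beta>. zz ^ (\<beta> - j) * pr Q j / tt ^ Suc (\<beta> - j))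
        + tt * P 0 * (- (zz ^ Suc \<beta> / tt ^ Suc (Suc \<beta>))
            + (\<Sum>j=0..\<beta>. zz ^ (\<beta> - j) * Dx (rr j) / tt ^ Suc (\<beta> - j))))"
  proof -
    have "(zz * ?\<tau>) ^ Suc \<beta> * pr P 0
        + (\<Sum>j=0..\<beta>. (zz * ?\<tau>) ^ (\<beta> - j) * (?\<tau> * (Dx (rr j) * (tt * P 0) - pr Q j)))
      = - (\<Sum>j=0..\<beta>. zz ^ (\<beta> - j) * pr Q j / tt ^ Suc (\<beta> - j))
        + tt * P 0 * (- (zz ^ Suc \<beta> / tt ^ Suc (Suc \<beta>))
            + (\<Sum>j=0..\<beta>. zz ^ (\<beta> - j) * Dx (rr j) / tt ^ Suc (\<beta> - j)))" for \<beta>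
      unfolding divide_alg_def inverse_power power_mult_distrib
      by (simp add: pr_def[of P 0] sum_distrib_left coordinate_inv_cancel sum_subtractf algebra_simps)
    then show ?thesis by simp
  qed
  also have "\<dots> \<longleftrightarrow> (\<forall>\<beta>\<ge>1. pr P \<beta> = - (\<Sum>j=0..\<beta>-1. zz ^ (\<beta> - j - 1) * pr Q j / tt ^ (\<beta> - j))
        + tt * P 0 * (- (zz ^ \<beta> / tt ^ (\<beta> + 1))
            + (\<Sum>j=1..\<beta>. zz ^ (\<beta> - j) * Dx (rr (j - 1)) / tt ^ (\<beta> - j + 1))))"
  proof -
    have "(\<Sum>j=0..Suc \<beta>-1. zz ^ (Suc \<beta> - j - 1) * pr Q j / tt ^ (Suc \<beta> - j))
        = (\<Sum>j=0..\<beta>. zz ^ (\<beta> - j) * pr Q j / tt ^ Suc (\<beta> - j))" for \<beta>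
      by (rule sum.cong) (auto simp: Suc_diff_le)
    moreover have "(\<Sum>j=1..Suc \<beta>. zz ^ (Suc \<beta> - j) * Dx (rr (j - 1)) / tt ^ (Suc \<beta> - j + 1))
        = (\<Sum>j=0..\<beta>. zz ^ (\<beta> - j) * Dx (rr j) / tt ^ Suc (\<beta> - j))" for \<beta>
      unfolding One_nat_def sum.shift_bounds_cl_Suc_ivl by simp
    ultimately show ?thesis unfolding all_ge_1 by simp
  qed
  finally have r: "(\<forall>\<beta>. pr (Rm P) \<beta> = pr Q \<beta>) \<longleftrightarrow> \<dots>" .
  show ?thesis
  proof (cases "P 0 = pm Q 0 / (tt * Dx (mm 0))")
    case True
    have "a / Dx (mm 0) * pm Q 0 = a * (tt * P 0)" "pm Q 0 / Dx (mm 0) = tt * P 0" for a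
      by (simp_all add: True divide_alg_def inverse_leading coordinate_inv_cancel ac_simps)
    note eq = this
    show ?thesis unfolding seq_eq_iff[of "Rm P"] q m r Suc_eq_plus1 eq using True by blast
  next
    case False
    then show ?thesis unfolding seq_eq_iff[of "Rm P"] m by blast
  qed
qed

section \<open>Linearity and conclusion\<close>

lemma Rq_combination: "Rq (\<lambda>n. a * P n + b * Q n) = (\<lambda>n. a * Rq P n + b * Rq Q n)"
proof -
  have "prev (pq (\<lambda>n. a * P n + b * Q n)) \<alpha> = a * prev (pq P) \<alpha> + b * prev (pq Q) \<alpha>"
    "prev (pm (\<lambda>n. a * P n + b * Q n)) \<alpha> = a * prev (pm P) \<alpha> + b * prev (pm Q) \<alpha>" for \<alpha>
    by (cases \<alpha>; simp add: prev_simps combination_select)+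
  then show ?thesis
    by (simp add: seq_eq_iff combination_select Rq_select algebra_simps)
qed

lemma Rm_combination: "Rm (\<lambda>n. a * P n + b * Q n) = (\<lambda>n. a * Rm P n + b * Rm Q n)"
  by (simp add: Rm_def Rq_combination algebra_simps)

text \<open>Since \<open>R (inv R P) = P\<close>, invariance under the inverse amounts to reflecting
  membership in \<open>tau_sym\<close> along \<open>R\<close>.\<close>

lemma recursion_operator_inv:
  assumes lin: "\<And>a b P Q. R (\<lambda>n. a * P n + b * Q n) = (\<lambda>n. a * R P n + b * R Q n)"
    and R: "bij R" and sym: "\<And>P. R P \<in> tau_sym \<Longrightarrow> P \<in> tau_sym"
  shows "recursion_operator (inv R)"
proof -
  have Rinv: "R (inv R P) = P" for P using R by (simp add: bij_is_surj surj_f_inv_f)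
  have inv: "inv R (\<lambda>n. a * P n + b * Q n) = (\<lambda>n. a * inv R P n + b * inv R Q n)" for a b P Q
    by (rule inv_f_eq[OF bij_is_inj[OF R]]) (simp add: lin Rinv)
  have "inv R (\<lambda>n. P n + Q n) = (\<lambda>n. inv R P n + inv R Q n)" for P Q
    using inv[of 1 P 1 Q] by simp
  moreover have "inv R (\<lambda>n. k *\<^sub>R P n) = (\<lambda>n. k *\<^sub>R inv R P n)" for k P
    \<comment> \<open>Real scaling is multiplication by a constant of the algebra.\<close>
    using inv[of "of_real k" P 0 P] by (simp add: scaleR_conv_of_real)
  ultimately show ?thesis
    unfolding recursion_operator_def real_linear_def using sym Rinv by metis
qed

theorem proposition3:
  shows "module_endomorphism Rq \<and> bij Rq \<and> bij Rm \<and>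
    (\<forall>P'. let P = inv Rq P' in
       P 0 = pq P' 0 / Dx (qq 0) \<and>
       (\<forall>\<alpha>. pq P \<alpha> = - (Dx (qq (\<alpha> + 1)) / Dx (qq 0)) * pq P' 0 + pq P' (\<alpha> + 1)) \<and>
       (\<forall>\<alpha>. pm P \<alpha> = (\<Sum>j=0..\<alpha>. tt * pm P' j / (- zz) ^ (\<alpha> - j + 1))
          - tt * pq P' 0 / Dx (qq 0) * (\<Sum>j=0..\<alpha>. Dx (mm j) / (- zz) ^ (\<alpha> - j + 1))) \<and>
       (\<forall>\<beta>\<ge>1. pr P \<beta> = Dx (rr (\<beta> - 1)) / Dx (qq 0) * pq P' 0 - pr P' (\<beta> - 1))) \<and>
    (\<forall>P'. let P = inv Rm P' in
       P 0 = pm P' 0 / (tt * Dx (mm 0)) \<and>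
       (\<forall>\<alpha>. pq P \<alpha> = (\<Sum>j=0..\<alpha>. (- tt) ^ (\<alpha> - j) * pq P' j / zz ^ (\<alpha> - j + 1))
          - pm P' 0 / Dx (mm 0) * (\<Sum>j=0..\<alpha>. (- tt) ^ (\<alpha> - j) * Dx (qq j) / zz ^ (\<alpha> - j + 1))) \<and>
       (\<forall>\<alpha>. pm P \<alpha> = Dx (mm (\<alpha> + 1)) / Dx (mm 0) * pm P' 0 - pm P' (\<alpha> + 1)) \<and>
       (\<forall>\<beta>\<ge>1. pr P \<beta> = - (\<Sum>j=0..\<beta>-1. zz ^ (\<beta> - j - 1) * pr P' j / tt ^ (\<beta> - j))
          + pm P' 0 / Dx (mm 0) * (- (zz ^ \<beta> / tt ^ (\<beta> + 1))
              + (\<Sum>j=1..\<beta>. zz ^ (\<beta> - j) * Dx (rr (j - 1)) / tt ^ (\<beta> - j + 1))))) \<and>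
    recursion_operator (inv Rq) \<and> recursion_operator (inv Rm)"
proof -
  have Rq: "bij Rq" by (rule bij_explicit) (rule Rq_eq_iff)
  have Rm: "bij Rm" by (rule bij_explicit) (rule Rm_eq_iff)
  have "module_endomorphism Rq"
    unfolding module_endomorphism_def
  proof (intro conjI allI)
    show "Rq (\<lambda>n. P n + Q n) = (\<lambda>n. Rq P n + Rq Q n)" for P Q
      using Rq_combination[of 1 P 1 Q] by simp
    show "Rq (\<lambda>n. a * P n) = (\<lambda>n. a * Rq P n)" for a P
      using Rq_combination[of a P 0 P] by simp
  qed
  moreover note Rq Rm
  moreover have "recursion_operator (inv Rq)"
    by (rule recursion_operator_inv[OF Rq_combination Rq tau_sym_Rq])
  moreover have "recursion_operator (inv Rm)"
    by (rule recursion_operator_inv[OF Rm_combination Rm tau_sym_Rm])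
  moreover note Rq_eq_iff[THEN iffD1, OF surj_f_inv_f[OF bij_is_surj[OF Rq]]]
    Rm_eq_iff[THEN iffD1, OF surj_f_inv_f[OF bij_is_surj[OF Rm]]]
  ultimately show ?thesis unfolding Let_def by blast
qed

end
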